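(* Let $\mathcal{A}=\{A_1,\dots,A_m\}\subseteq\mathbb{R}^{n\times n}$ be a switched linear system, let $\hat{\mathcal{A}}=\{\hat A_1,\dots,\hat A_m\}\subseteq\mathbb{R}^{n\times n}$ be a model switched linear system, and let $\delta\ge 1$. Let $P$ be a minimizer of $\gamma(\cdot,\hat{\mathcal{A}})$ over the symmetric positive definite matrices satisfying $I\preceq P\preceq\delta I$, and let $\rho_{\mathrm{quad}}(\hat{\mathcal{A}},\delta)$ be the minimum value. Let $\epsilon>0$ and $W\ge 0$. Assume that there is $\alpha>0$ with $\mu^{\mathrm{mode}}(j)\ge\alpha$ for all $j\in[m]$, and that $\mu^{\mathrm{noise}}(\{w\in\mathbb{R}^n:\|w\|_2>W'\})\le p(W')$ for all $W'\ge 0$. Let $\hat q\ge Q^{\mathrm{error}}_{\mathcal{A},\hat{\mathcal{A}}}(\epsilon)$. Then $$\rho(\mathcal{A})\le\frac{\rho_{\mathrm{quad}}(\hat{\mathcal{A}},\delta)+(\epsilon+W)\sqrt{\overline\kappa(P)}}{\zeta\!\left(\frac{\hat q}{2(1-p(W))\alpha}\,\kappa(P)\right)},$$ where $\overline\kappa(P)=\lambda_{\max}(P)/\lambda_{\min}(P)$ and $\kappa(P)=\sqrt{\det(P)/\lambda_{\min}(P)^n}$.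
   Context: Let $n\ge 2$, $m\ge 1$, $[m]=\{1,\dots,m\}$, and $\mathbb{S}^{n-1}$ the Euclidean unit sphere of $\mathbb{R}^n$. A trajectory of $\mathcal{A}$ is a function $\xi:\mathbb{N}\to\mathbb{R}^n$ with $\xi(t+1)\in\{A\xi(t):A\in\mathcal{A}\}$ for all $t$. The joint spectral radius $\rho(\mathcal{A})$ is the infimum of all $r\ge 0$ for which there is $C\ge 1$ such that every trajectory satisfies $\|\xi(t)\|\le Cr^t\|\xi(0)\|$ for all $t\in\mathbb{N}$. For a symmetric positive definite $P$, $\|x\|_P=(x^\top Px)^{1/2}$. For a finite set of matrices $\mathcal{B}$, $\gamma(P,\mathcal{B})=\max_{x\ne 0,\,B\in\mathcal{B}}\|Bx\|_P/\|x\|_P$, and $\rho_{\mathrm{quad}}(\mathcal{B},\delta)=\inf\{\gamma(P,\mathcal{B}):P\text{ symmetric},\ I\preceq P\preceq\delta I\}$ (attained by compactness). Probability setting: $\Delta=\mathbb{S}^{n-1}\times[m]\times\mathcal{W}$ with $\mathcal{W}\subseteq\mathbb{R}^n$ the set of noise values, and $\pi=\mu^{\mathrm{state}}\times\mu^{\mathrm{mode}}\times\mu^{\mathrm{noise}}$ is a product probability distribution on $\Delta$, where $\mu^{\mathrm{state}}$ is the uniform distribution on $\mathbb{S}^{n-1}$, $\mu^{\mathrm{mode}}$ is a distribution on $[m]$ and $\mu^{\mathrm{noise}}$ is a distribution on $\mathcal{W}$. The function $p:[0,\infty)\to[0,1]$ is a given tail bound. Prediction error: $e_{\mathcal{A},\hat{\mathcal{A}}}(x,j,w)=\min_{k\in[m]}\|\hat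 A_kx-A_jx+w\|_2$ for $(x,j,w)\in\Delta$, and $Q^{\mathrm{error}}_{\mathcal{A},\hat{\mathcal{A}}}(\epsilon)=\pi(\{(x,j,w)\in\Delta:e_{\mathcal{A},\hat{\mathcal{A}}}(x,j,w)>\epsilon\})$. $\zeta(x)=\sqrt{1-I^{-1}(2x;(n-1)/2;1/2)}$, where $I(x;a;b)=\int_0^xt^{a-1}(1-t)^{b-1}\,dt\big/\int_0^1t^{a-1}(1-t)^{b-1}\,dt$ is the regularized incomplete beta function and $I^{-1}(\cdot;a;b):[0,1]\to[0,1]$ is its inverse in the first variable; thus $\zeta$ is defined for $0\le x\le 1/2$, with $\zeta(0)=1$ and $\zeta(1/2)=0$. Convention: if $p(W)=1$ or the argument of $\zeta$ is $\ge 1/2$, the right-hand side of the bound is interpreted as $+\infty$. *)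

theory Defs
  imports "HOL-Probability.Probability"
begin

definition trajectory :: "(real^'n^'n) set \<Rightarrow> (nat \<Rightarrow> real^'n) \<Rightarrow> bool" where
  "trajectory \<A> \<xi> \<longleftrightarrow> (\<forall>t. \<xi> (Suc t) \<in> {A *v \<xi> t | A. A \<in> \<A>})"

definition joint_spectral_radius :: "(real^'n^'n) set \<Rightarrow> real" where
  "joint_spectral_radius \<A> =
     Inf {r. 0 \<le> r \<and> (\<exists>C\<ge>1. \<forall>\<xi>. trajectory \<A> \<xi> \<longrightarrow> (\<forall>t. norm (\<xi> t) \<le> C * r ^ t * norm (\<xi> 0)))}"

definition pos_semidef :: "real^'n^'n \<Rightarrow> bool" where
  "pos_semidef M \<longleftrightarrow> transpose M = M \<and> (\<forall>x. 0 \<le> x \<bullet> (M *v x))"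

definition loewner_le :: "real^'n^'n \<Rightarrow> real^'n^'n \<Rightarrow> bool"  (infix \<open>\<preceq>\<close> 50) where
  "M \<preceq> N \<longleftrightarrow> pos_semidef (N - M)"

definition quad_norm :: "real^'n^'n \<Rightarrow> real^'n \<Rightarrow> real" where
  "quad_norm P x = sqrt (x \<bullet> (P *v x))"

(* For positive definite P and finite nonempty B this supremum is attained, by homogeneity
   and compactness of the unit sphere. *)
definition quad_gain :: "real^'n^'n \<Rightarrow> (real^'n^'n) set \<Rightarrow> real" where
  "quad_gain P \<B> = (SUP (x, B) \<in> (UNIV - {0}) \<times> \<B>. quad_norm P (B *v x) / quad_norm P x)"

definition quad_feasible :: "real \<Rightarrow> real^'n^'n \<Rightarrow> bool" where
  "quad_feasible \<delta> P \<longleftrightarrow> transpose P = P \<and> mat 1 \<preceq> P \<and> P \<preceq> \<delta> *\<^sub>R mat 1"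

definition rho_quad :: "(real^'n^'n) set \<Rightarrow> real \<Rightarrow> real" where
  "rho_quad \<B> \<delta> = (INF P \<in> {P. quad_feasible \<delta> P}. quad_gain P \<B>)"

definition eigenvalues :: "real^'n^'n \<Rightarrow> real set" where
  "eigenvalues P = {l. \<exists>v. v \<noteq> 0 \<and> P *v v = l *\<^sub>R v}"

definition lambda_max :: "real^'n^'n \<Rightarrow> real" where
  "lambda_max P = Max (eigenvalues P)"

definition lambda_min :: "real^'n^'n \<Rightarrow> real" where
  "lambda_min P = Min (eigenvalues P)"

definition kappa_bar :: "real^'n^'n \<Rightarrow> real" where
  "kappa_bar P = lambda_max P / lambda_min P"

definition kappa :: "real^'n^'n \<Rightarrow> real" where
  "kappa P = sqrt (det P / lambda_min P ^ CARD('n))"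

(* The normalised surface measure as cone measure: a Borel subset of the sphere has the
   probability that the radial projection of a uniform point of the unit ball lies in it. *)
definition uniform_sphere :: "'a::euclidean_space measure" where
  "uniform_sphere =
     restrict_space (distr (uniform_measure lborel (ball 0 1)) borel sgn) (sphere 0 1)"

lemma space_uniform_sphere: "space uniform_sphere = sphere 0 1"
  by (simp add: uniform_sphere_def space_restrict_space)

lemma sets_uniform_sphere: "sets uniform_sphere = sets (restrict_space borel (sphere 0 1))"
  by (simp add: uniform_sphere_def sets_restrict_space)

lemma emeasure_uniform_sphere:
  assumes "B \<in> sets uniform_sphere"
  shows "emeasure uniform_sphere (B :: 'a::euclidean_space set) =
    emeasure lborel {x \<in> ball 0 1. sgn x \<in> B} / emeasure lborel (ball (0::'a) 1)"
proof -
  have B: "B \<in> sets borel" "B \<subseteq> sphere 0 1"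
    using assms by (auto simp: sets_uniform_sphere sets_restrict_space_iff)
  have m: "sgn \<in> measurable lborel (borel :: 'a measure)" by simp
  have eq: "ball 0 1 \<inter> sgn -` B = {x \<in> ball 0 1. sgn x \<in> B}" by auto
  have "sgn -` B \<in> sets lborel" using measurable_sets[OF m B(1)] by simp
  then show ?thesis
    using B by (simp add: uniform_sphere_def emeasure_restrict_space emeasure_distr eq)
qed

lemma prob_space_uniform_sphere: "prob_space (uniform_sphere :: 'a::euclidean_space measure)"
proof
  let ?b = "ball (0::'a) 1"
  have fin: "emeasure lborel ?b \<noteq> \<infinity>"
    using emeasure_lborel_ball_finite[of "0::'a" 1] by simp
  have pos: "emeasure lborel ?b \<noteq> 0"
    using unit_ball_vol_pos[of "real DIM('a)"] by (simp add: emeasure_ball del: unit_ball_vol_pos)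
  have "{x \<in> ?b. sgn x \<in> sphere 0 1} = ?b - {0}"
    by (auto simp: norm_sgn)
  then have "emeasure lborel {x \<in> ?b. sgn x \<in> sphere 0 1} = emeasure lborel ?b"
    by (simp add: emeasure_Diff)
  then show "emeasure uniform_sphere (space (uniform_sphere :: 'a measure)) = 1"
    using fin pos emeasure_uniform_sphere[OF sets.top, where 'a='a]
    by (simp add: space_uniform_sphere ennreal_divide_self less_top)
qed

definition prediction_error ::
  "nat \<Rightarrow> (nat \<Rightarrow> real^'n^'n) \<Rightarrow> (nat \<Rightarrow> real^'n^'n) \<Rightarrow> (real^'n) \<times> nat \<times> (real^'n) \<Rightarrow> real" where
  "prediction_error m A Ah = (\<lambda>(x, j, w). MIN k\<in>{1..m}. norm (Ah k *v x - A j *v x + w))"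

definition Q_error ::
  "nat \<Rightarrow> (nat \<Rightarrow> real^'n^'n) \<Rightarrow> (nat \<Rightarrow> real^'n^'n) \<Rightarrow> nat measure \<Rightarrow> (real^'n) measure \<Rightarrow> real \<Rightarrow> real" where
  "Q_error m A Ah \<mu>_mode \<mu>_noise \<epsilon> =
     (let \<pi> = uniform_sphere \<Otimes>\<^sub>M (\<mu>_mode \<Otimes>\<^sub>M \<mu>_noise)
      in measure \<pi> {\<omega> \<in> space \<pi>. prediction_error m A Ah \<omega> > \<epsilon>})"

definition reg_inc_beta :: "real \<Rightarrow> real \<Rightarrow> real \<Rightarrow> real" where
  "reg_inc_beta x a b =
     integral {0..x} (\<lambda>t. t powr (a - 1) * (1 - t) powr (b - 1)) /
     integral {0..1} (\<lambda>t. t powr (a - 1) * (1 - t) powr (b - 1))"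

definition inv_reg_inc_beta :: "real \<Rightarrow> real \<Rightarrow> real \<Rightarrow> real" where
  "inv_reg_inc_beta y a b = the_inv_into {0..1} (\<lambda>x. reg_inc_beta x a b) y"

(* meaningful for n > 1 and 0 <= x <= 1/2 *)
definition zeta :: "nat \<Rightarrow> real \<Rightarrow> real" where
  "zeta n x = sqrt (1 - inv_reg_inc_beta (2 * x) ((real n - 1) / 2) (1 / 2))"

end

theory Submission
  imports Defs
begin

text \<open>
  Fix a mode \<open>j\<close> and put \<open>G = \<rho>\<^sub>q\<^sub>u\<^sub>a\<^sub>d + (\<epsilon> + W) \<surd>(kappa_bar P)\<close>.
  If some model matrix predicts \<open>A j *v x\<close> up to \<open>\<epsilon> + W\<close>, the \<open>P\<close>-norm of \<open>x\<close> grows at most by the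
  factor \<open>G\<close> (lemma \<open>quad_norm_le_of_close\<close>). If no model matrix does, every noise value of norm at
  most \<open>W\<close> produces a prediction error above \<open>\<epsilon>\<close>; since state, mode and noise are independent,
  such \<open>x\<close> fill at most the fraction \<open>\<eta> = q / ((1 - p W) \<alpha>)\<close> of the sphere
  (lemma \<open>mismatch_measure_le_Q_error\<close>).

  It remains to turn a gain bound valid outside a small set of directions into one valid
  everywhere (lemma \<open>quad_norm_bound_from_bad_directions\<close>). Write \<open>P\<close> as \<open>transpose L ** L\<close>
  and substitute \<open>y = L *v x\<close>. The bad directions span a cone; \<open>L\<close> multiplies volumes by
  \<open>\<surd>det P\<close>, and the preimage of the unit ball lies in a ball of radius \<open>1 / \<surd>\<lambda>\<^sub>m\<^sub>i\<^sub>n\<close>, so the transformed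
  cone fills at most the fraction \<open>\<eta> * kappa P\<close> of the unit ball. If \<open>s\<close> is the operator norm of
  the transformed matrix \<open>B\<close> and \<open>v\<close> a top right singular vector, then \<open>\<parallel>B y\<parallel> \<ge> s \<bar>v \<bullet> y\<bar>\<close>, so every \<open>y\<close>
  with \<open>\<bar>v \<bullet> y\<bar> > (G / s) \<parallel>y\<parallel>\<close> is bad. The bad cone thus contains a double cone around \<open>v\<close>
  whose fraction of the ball is the regularized incomplete beta function at \<open>1 - (G / s)\<^sup>2\<close>; comparing
  the two fractions gives \<open>G / s \<ge> zeta\<close>, that is \<open>s \<le> G / zeta\<close>. A common
  one-step contraction factor for the norm of \<open>P\<close> bounds the joint spectral radius
  (lemma \<open>joint_spectral_radius_le\<close>).

  The volume of the double cone comes from slicing it orthogonally to its axis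
  (lemma \<open>emeasure_axis_double_cone\<close>): the slices are balls, their volumes integrate to
  \<open>cap_profile\<close>, and differentiating \<open>cap_profile\<close> in the squared sine of the opening angle
  yields exactly the beta integrand.
\<close>

section \<open>Symmetric matrices and their quadratic forms\<close>

lemma inner_symmetric_matrix:
  fixes M :: "real^'n^'n"
  assumes "transpose M = M"
  shows "x \<bullet> (M *v y) = (M *v x) \<bullet> y"
  by (metis assms dot_lmul_matrix transpose_matrix_vector)

text \<open>
  The maximizer of the Rayleigh quotient on the unit sphere is an eigenvector. It is used for a
  positive definite matrix, for its negative, and for \<open>transpose B ** B\<close>.
\<close>

lemma symmetric_top_eigenvector:
  fixes M :: "real^'n^'n"
  assumes sym: "transpose M = M"
  obtains v l where "norm v = 1" "M *v v = l *\<^sub>R v" "\<And>x. x \<bullet> (M *v x) \<le> l * (x \<bullet> x)"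
proof -
  have "sphere (0::real^'n) 1 \<noteq> {}"
    using vector_choose_size[of 1, where 'a="real^'n"] by auto
  moreover have "continuous_on (sphere 0 1) (\<lambda>x::real^'n. x \<bullet> (M *v x))"
    by (intro continuous_intros linear_continuous_on_compose[OF continuous_on_id]) simp
  ultimately obtain v where v: "norm v = 1"
    and vmax: "\<And>y. norm y = 1 \<Longrightarrow> y \<bullet> (M *v y) \<le> v \<bullet> (M *v v)"
    using continuous_attains_sup[of "sphere (0::real^'n) 1" "\<lambda>x. x \<bullet> (M *v x)"] by auto
  define l where "l = v \<bullet> (M *v v)"
  have le: "x \<bullet> (M *v x) \<le> l * (x \<bullet> x)" for x
  proof (cases "x = 0")
    case False
    have "sgn x \<bullet> (M *v sgn x) \<le> l"
      using vmax[of "sgn x"] False by (simp add: norm_sgn l_def)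
    moreover have "x = norm x *\<^sub>R sgn x"
      using False by (simp add: sgn_div_norm)
    then have "x \<bullet> (M *v x) = (norm x)\<^sup>2 * (sgn x \<bullet> (M *v sgn x))"
      by (metis inner_scaleR_left inner_scaleR_right matrix_vector_mult_scaleR mult.assoc power2_eq_square)
    ultimately show ?thesis
      using mult_right_mono[of "sgn x \<bullet> (M *v sgn x)" l "x \<bullet> x"]
      by (simp add: mult.commute power2_norm_eq_inner)
  qed simp
  define d where "d = M *v v - l *\<^sub>R v"
  define Q where "Q = l * (d \<bullet> d) - d \<bullet> (M *v d)"
  (* The form l|x|^2 - <x, Mx> is nonnegative and vanishes at v, so its first variation there,
     taken in the direction of the defect d, has to vanish. *)
  have var: "2 * t * (d \<bullet> d) \<le> t\<^sup>2 * Q" for t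
  proof -
    have dd: "d \<bullet> d = d \<bullet> (M *v v) - l * (d \<bullet> v)"
      by (subst (2) d_def) (simp add: inner_diff_right)
    have "0 \<le> l * ((v + t *\<^sub>R d) \<bullet> (v + t *\<^sub>R d)) - (v + t *\<^sub>R d) \<bullet> (M *v (v + t *\<^sub>R d))"
      using le[of "v + t *\<^sub>R d"] by simp
    also have "\<dots> = (l * (v \<bullet> v) - v \<bullet> (M *v v)) - 2 * t * (d \<bullet> (M *v v) - l * (d \<bullet> v)) + t\<^sup>2 * Q"
      using inner_symmetric_matrix[OF sym, of v d]
      by (simp add: Q_def inner_add_left inner_add_right matrix_vector_right_distrib
          matrix_vector_mult_scaleR inner_commute power2_eq_square algebra_simps)
    also have "l * (v \<bullet> v) - v \<bullet> (M *v v) = 0"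
      using v by (simp add: l_def norm_eq_1)
    finally show ?thesis by (simp add: dd)
  qed
  have "d \<bullet> d \<le> 0"
  proof (cases "Q \<le> 0")
    case True
    with var[of 1] show ?thesis by simp
  next
    case False
    then have "2 * (d \<bullet> d) * (d \<bullet> d) / Q \<le> (d \<bullet> d) * (d \<bullet> d) / Q"
      using var[of "(d \<bullet> d) / Q"] by (simp add: power2_eq_square)
    then have "(d \<bullet> d) * (d \<bullet> d) \<le> 0"
      using False by (simp add: divide_le_cancel)
    then show ?thesis
      by (metis inner_ge_zero mult_eq_0_iff order_antisym order_refl zero_le_mult_iff)
  qed
  then have "d = 0"
    by (metis inner_eq_zero_iff inner_ge_zero order_antisym)
  then show thesis
    using that[OF v _ le] by (simp add: d_def)
qed

text \<open>
  Eigenvectors for distinct eigenvalues are orthogonal, hence linearly independent. Finiteness is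
  what makes \<^const>\<open>lambda_min\<close> and \<^const>\<open>lambda_max\<close> genuine extrema.
\<close>

lemma finite_eigenvalues:
  fixes P :: "real^'n^'n"
  assumes sym: "transpose P = P"
  shows "finite (eigenvalues P)"
proof -
  have "\<forall>l\<in>eigenvalues P. \<exists>v. v \<noteq> 0 \<and> P *v v = l *\<^sub>R v"
    by (simp add: eigenvalues_def)
  then obtain e where e: "\<And>l. l \<in> eigenvalues P \<Longrightarrow> e l \<noteq> 0 \<and> P *v e l = l *\<^sub>R e l"
    by (metis bchoice)
  have orth: "e l \<bullet> e k = 0" if "l \<in> eigenvalues P" "k \<in> eigenvalues P" "l \<noteq> k" for l k
    using inner_symmetric_matrix[OF sym, of "e l" "e k"] e that by auto
  have inj: "inj_on e (eigenvalues P)"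
    by (intro inj_onI) (metis e orth inner_eq_zero_iff)
  have "independent (e ` eigenvalues P)"
  proof (rule pairwise_orthogonal_independent)
    show "pairwise orthogonal (e ` eigenvalues P)"
      using orth by (auto simp: pairwise_def orthogonal_def)
    show "0 \<notin> e ` eigenvalues P"
      using e by force
  qed
  then show ?thesis
    using inj independent_imp_finite finite_imageD by blast
qed

lemma quadratic_form_le_lambda_max:
  fixes P :: "real^'n^'n"
  assumes sym: "transpose P = P"
  shows "x \<bullet> (P *v x) \<le> lambda_max P * (x \<bullet> x)"
proof -
  obtain v l where v: "norm v = 1" "P *v v = l *\<^sub>R v" and l: "\<And>x. x \<bullet> (P *v x) \<le> l * (x \<bullet> x)"
    using symmetric_top_eigenvector[OF sym] by blast
  have "l \<in> eigenvalues P"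
    using v by (auto simp: eigenvalues_def intro!: exI[of _ v])
  then have "l \<le> lambda_max P"
    by (simp add: lambda_max_def finite_eigenvalues[OF sym])
  then show ?thesis
    using l[of x] mult_right_mono[of l "lambda_max P" "x \<bullet> x"] by simp
qed

lemma lambda_min_properties:
  fixes P :: "real^'n^'n"
  assumes sym: "transpose P = P"
  shows lambda_min_le_quadratic_form: "lambda_min P * (x \<bullet> x) \<le> x \<bullet> (P *v x)"
    and lambda_min_in_eigenvalues: "lambda_min P \<in> eigenvalues P"
proof -
  have sym': "transpose (- P) = - P"
    using sym by (simp add: transpose_def vec_eq_iff)
  have neg: "(- P) *v x = - (P *v x)" for x
    by (simp add: matrix_vector_mult_def vec_eq_iff sum_negf)
  obtain v l where v: "norm v = 1" "- (P *v v) = l *\<^sub>R v"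
    and l: "\<And>x. x \<bullet> - (P *v x) \<le> l * (x \<bullet> x)"
    using symmetric_top_eigenvector[OF sym'] unfolding neg by blast
  have "P *v v = (- l) *\<^sub>R v"
    using v(2) by (metis add.inverse_inverse scaleR_minus_left)
  then have ev: "- l \<in> eigenvalues P"
    using v by (auto simp: eigenvalues_def intro!: exI[of _ v])
  then show "lambda_min P \<in> eigenvalues P"
    unfolding lambda_min_def by (intro Min_in finite_eigenvalues[OF sym]) auto
  have "lambda_min P \<le> - l"
    using ev by (simp add: lambda_min_def finite_eigenvalues[OF sym])
  then show "lambda_min P * (x \<bullet> x) \<le> x \<bullet> (P *v x)"
    using l[of x] mult_right_mono[of "lambda_min P" "- l" "x \<bullet> x"] by simp
qed

lemma lambda_min_le_lambda_max:
  fixes P :: "real^'n^'n"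
  assumes sym: "transpose P = P"
  shows "lambda_min P \<le> lambda_max P"
proof -
  obtain x :: "real^'n" where "norm x = 1"
    using vector_choose_size[of 1, where 'a="real^'n"] by auto
  then show ?thesis
    using lambda_min_le_quadratic_form[OF sym, of x] quadratic_form_le_lambda_max[OF sym, of x]
    by (simp add: norm_eq_1)
qed

lemma lambda_min_pos:
  fixes P :: "real^'n^'n"
  assumes sym: "transpose P = P" and pos: "\<And>x. x \<noteq> 0 \<Longrightarrow> 0 < x \<bullet> (P *v x)"
  shows "0 < lambda_min P"
proof -
  obtain v where "v \<noteq> 0" "P *v v = lambda_min P *\<^sub>R v"
    using lambda_min_in_eigenvalues[OF sym] by (auto simp: eigenvalues_def)
  with pos[of v] have "0 < lambda_min P * (v \<bullet> v)" "0 < v \<bullet> v"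
    by simp_all
  then show ?thesis
    by (rule zero_less_mult_pos2)
qed

text \<open>
  Gram-Schmidt for the inner product \<open>x \<bullet> (P *v y)\<close> produces a basis that is orthonormal for
  it; with the basis as rows of \<open>R\<close>, the matrix \<open>R ** P\<close> is the required factor.
\<close>

lemma positive_definite_factorization:
  fixes P :: "real^'n^'n"
  assumes sym: "transpose P = P" and pos: "\<And>x. x \<noteq> 0 \<Longrightarrow> 0 < x \<bullet> (P *v x)"
  obtains L :: "real^'n^'n" where "transpose L ** L = P"
proof -
  define ON where "ON S \<longleftrightarrow> finite S \<and> (\<forall>x\<in>S. \<forall>y\<in>S. x \<bullet> (P *v y) = (if x = y then 1 else 0))"
    for S :: "(real^'n) set"
  have coef: "(\<Sum>s\<in>S. c s *\<^sub>R s) \<bullet> (P *v y) = c y" if "ON S" "y \<in> S" for S c y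
  proof -
    have "(\<Sum>s\<in>S. c s *\<^sub>R s) \<bullet> (P *v y) = (\<Sum>s\<in>S. c s * (if s = y then 1 else 0))"
      using that by (simp add: inner_sum_left ON_def)
    also have "\<dots> = c y"
      using that by (simp add: ON_def mult_if_delta if_distrib cong: if_cong)
    finally show ?thesis .
  qed
  have ex: "\<exists>S. ON S \<and> card S = k" if "k \<le> CARD('n)" for k
    using that
  proof (induction k)
    case 0
    show ?case by (auto simp: ON_def intro!: exI[of _ "{}"])
  next
    case (Suc k)
    then obtain S where S: "ON S" "card S = k" by auto
    have "dim (span S) \<le> card S"
      using S unfolding ON_def dim_span by (intro dim_le_card') simp
    then have "span S \<noteq> UNIV"
      using S Suc.prems by (metis dim_UNIV DIM_cart DIM_real mult.right_neutral not_less_eq_eq dim_span)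
    then obtain x where x: "x \<notin> span S" by blast
    define c where "c s = x \<bullet> (P *v s)" for s
    define z where "z = x - (\<Sum>s\<in>S. c s *\<^sub>R s)"
    have "(\<Sum>s\<in>S. c s *\<^sub>R s) \<in> span S"
      by (intro span_sum span_scale span_base)
    then have "z \<noteq> 0"
      using x by (auto simp: z_def)
    then have zpos: "0 < z \<bullet> (P *v z)" by (rule pos)
    have zS: "z \<bullet> (P *v s) = 0" if "s \<in> S" for s
      using coef[OF S(1) that, of c] by (simp add: z_def inner_diff_left c_def)
    define w where "w = (1 / sqrt (z \<bullet> (P *v z))) *\<^sub>R z"
    have wS: "w \<bullet> (P *v s) = 0" if "s \<in> S" for s
      using zS[OF that] by (simp add: w_def)
    have Sw: "s \<bullet> (P *v w) = 0" if "s \<in> S" for s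
      using wS[OF that] by (simp add: inner_symmetric_matrix[OF sym, of s] inner_commute)
    have ww: "w \<bullet> (P *v w) = 1"
      using zpos by (simp add: w_def matrix_vector_mult_scaleR)
    have "w \<notin> S"
      using wS ww by force
    then have "ON (insert w S) \<and> card (insert w S) = Suc k"
      using S wS Sw ww by (auto simp: ON_def)
    then show ?case by blast
  qed
  then obtain S where S: "ON S" "card S = CARD('n)" by blast
  then obtain f where f: "bij_betw f (UNIV :: 'n set) S"
    by (metis ON_def finite_same_card_bij finite_class.finite_UNIV)
  define R :: "real^'n^'n" where "R = (\<chi> i. f i)"
  have "(R ** (P ** transpose R)) $ i $ j = f i \<bullet> (P *v f j)" for i j
    by (simp add: R_def matrix_matrix_mult_def matrix_vector_mult_def inner_vec_def transpose_def)
  also have "\<dots> i j = (if i = j then 1 else 0)" for i j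
    using S f by (auto simp: ON_def bij_betw_def inj_on_def)
  finally have "R ** (P ** transpose R) = mat 1"
    by (simp add: vec_eq_iff mat_def)
  then have "(P ** transpose R) ** R = mat 1"
    by (simp add: matrix_left_right_inverse)
  then have "transpose (R ** P) ** (R ** P) = P"
    by (simp add: matrix_transpose_mul sym matrix_mul_assoc)
  then show thesis by (rule that)
qed

text \<open>
  The lower bound holds because \<open>v\<close> is an eigenvector of \<open>transpose B ** B\<close>: the inner product
  of \<open>B *v x\<close> with \<open>B *v v\<close> equals \<open>s\<^sup>2 * (v \<bullet> x)\<close>, and \<open>B *v v\<close> has norm \<open>s\<close>.
\<close>

lemma top_singular_vector:
  fixes B :: "real^'n^'n"
  obtains v s where "norm v = 1" "0 \<le> s" "\<And>x. norm (B *v x) \<le> s * norm x"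
    "\<And>x. s * \<bar>v \<bullet> x\<bar> \<le> norm (B *v x)"
proof -
  have sym: "transpose (transpose B ** B) = transpose B ** B"
    by (simp add: matrix_transpose_mul)
  have form: "y \<bullet> ((transpose B ** B) *v x) = (B *v y) \<bullet> (B *v x)" for x y
    by (metis matrix_vector_mul_assoc dot_lmul_matrix transpose_matrix_vector transpose_transpose)
  obtain v l where v: "norm v = 1" "(transpose B ** B) *v v = l *\<^sub>R v"
    and l: "\<And>x. x \<bullet> ((transpose B ** B) *v x) \<le> l * (x \<bullet> x)"
    using symmetric_top_eigenvector[OF sym] by blast
  have vv: "v \<bullet> v = 1" using v by (simp add: norm_eq_1)
  have Bv: "(B *v x) \<bullet> (B *v v) = l * (v \<bullet> x)" for x
    using form[of x v] v(2) by (simp add: inner_commute)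
  have l_eq: "l = (norm (B *v v))\<^sup>2"
    using Bv[of v] vv by (simp add: power2_norm_eq_inner)
  define s where "s = norm (B *v v)"
  have "norm (B *v x) \<le> s * norm x" for x
  proof (rule power2_le_imp_le)
    show "(norm (B *v x))\<^sup>2 \<le> (s * norm x)\<^sup>2"
      using l[of x] by (simp add: form l_eq s_def power_mult_distrib power2_norm_eq_inner)
  qed (simp add: s_def)
  moreover have "s * \<bar>v \<bullet> x\<bar> \<le> norm (B *v x)" for x
  proof (cases "s = 0")
    case False
    have "s * (s * \<bar>v \<bullet> x\<bar>) = \<bar>(B *v x) \<bullet> (B *v v)\<bar>"
      using Bv[of x] by (simp add: l_eq s_def abs_mult power2_eq_square)
    also have "\<dots> \<le> s * norm (B *v x)"
      using Cauchy_Schwarz_ineq2[of "B *v x" "B *v v"] by (simp add: s_def mult.commute)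
    finally show ?thesis
      using False by (simp add: s_def)
  qed simp
  ultimately show thesis
    using that[of v s] v by (simp add: s_def)
qed

section \<open>Spherical caps and the incomplete beta function\<close>

text \<open>
  Up to the factor \<^term>\<open>2 * unit_ball_vol (real k)\<close> this is the volume of the part of the unit
  ball in dimension \<^term>\<open>k + 1\<close> that makes an angle with squared sine at most \<^term>\<open>t\<close> with a given
  line. The first summand is the cone over the base disc of the cap, the second the cap itself.
\<close>

definition cap_profile :: "nat \<Rightarrow> real \<Rightarrow> real" where
  "cap_profile k t =
     sqrt (1 - t) * sqrt t ^ k / (real k + 1) + integral {sqrt (1 - t)..1} (\<lambda>s. sqrt (1 - s\<^sup>2) ^ k)"

lemma cap_profile_0: "k \<ge> 1 \<Longrightarrow> cap_profile k 0 = 0"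
  by (simp add: cap_profile_def)

text \<open>
  With \<open>r = \<surd>t\<close> and \<open>u = \<surd>(1 - t)\<close> the derivative is a multiple of
  \<open>r ^ (k - 2) / u * (r\<^sup>2 + u\<^sup>2)\<close>, and the last factor is \<open>1\<close>.
\<close>

lemma cap_profile_has_real_derivative:
  assumes k: "k \<ge> 1" and t: "0 < t" "t < 1"
  shows "(cap_profile k has_real_derivative
           k / (2 * (real k + 1)) * (t powr (k / 2 - 1) * (1 - t) powr (1 / 2 - 1))) (at t)"
proof -
  define r u where "r = sqrt t" and "u = sqrt (1 - t)"
  have ru: "0 < r" "0 < u" "r\<^sup>2 = t" "u\<^sup>2 = 1 - t" "u < 1"
    using t by (auto simp: r_def u_def)
  have int: "((\<lambda>x. integral {x..1} (\<lambda>s. sqrt (1 - s\<^sup>2) ^ k)) has_real_derivative - (r ^ k)) (at u)"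
  proof -
    have "((\<lambda>x. integral {x..1} (\<lambda>s. sqrt (1 - s\<^sup>2) ^ k)) has_real_derivative
           - (sqrt (1 - u\<^sup>2) ^ k)) (at u within {0..1})"
      using ru by (intro integral_has_real_derivative') (auto intro!: continuous_intros)
    then show ?thesis
      using ru by (simp add: at_within_Icc_at r_def)
  qed
  have du: "((\<lambda>t. sqrt (1 - t)) has_real_derivative - 1 / (2 * u)) (at t)"
    using t by (auto intro!: derivative_eq_intros simp: u_def field_simps)
  have dr: "((\<lambda>t. sqrt t) has_real_derivative 1 / (2 * r)) (at t)"
    using t by (auto intro!: derivative_eq_intros simp: r_def field_simps)
  have dI: "((\<lambda>t. integral {sqrt (1 - t)..1} (\<lambda>s. sqrt (1 - s\<^sup>2) ^ k)) has_real_derivative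
              - (r ^ k) * (- 1 / (2 * u))) (at t)"
    using DERIV_chain2[OF int[unfolded u_def] du] by (simp add: u_def)
  have prod: "((\<lambda>t. sqrt (1 - t) * sqrt t ^ k / (real k + 1)) has_real_derivative
              ((- 1 / (2 * u)) * r ^ k + u * (real k * r ^ (k - 1) * (1 / (2 * r)))) / (real k + 1)) (at t)"
    by (rule derivative_eq_intros du dr refl | simp add: r_def u_def)+
  have powers: "t powr (k / 2 - 1) = r ^ k / r\<^sup>2" "(1 - t) powr (1 / 2 - 1) = 1 / u"
  proof -
    have "t powr (real k / 2) = (t powr (1 / 2)) powr real k"
      by (simp add: powr_powr)
    also have "\<dots> = r ^ k"
      using ru t by (simp add: powr_half_sqrt r_def powr_realpow)
    finally show "t powr (k / 2 - 1) = r ^ k / r\<^sup>2"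
      using ru t by (simp add: powr_diff)
    have "(1 - t) powr (1 / 2 - 1) = (1 - t) powr - (1 / 2)"
      by simp
    also have "\<dots> = 1 / u"
      using t by (simp only: powr_minus_divide) (simp add: powr_half_sqrt u_def)
    finally show "(1 - t) powr (1 / 2 - 1) = 1 / u" .
  qed
  obtain j where j: "k = Suc j"
    using k by (cases k) auto
  have pyth: "r * r + u * u = 1"
    using ru by (simp add: power2_eq_square)
  have "((- 1 / (2 * u)) * r ^ k + u * (real k * r ^ (k - 1) * (1 / (2 * r)))) / (real k + 1)
          + - (r ^ k) * (- 1 / (2 * u))
        = k / (2 * (real k + 1)) * (r ^ k / r\<^sup>2 * (1 / u)) * (r * r + u * u)"
    using ru(1,2) by (simp add: j divide_simps power2_eq_square) (simp add: algebra_simps)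
  also have "\<dots> = k / (2 * (real k + 1)) * (t powr (k / 2 - 1) * (1 - t) powr (1 / 2 - 1))"
    by (simp only: powers pyth mult_1_right)
  finally show ?thesis
    unfolding cap_profile_def[abs_def] using DERIV_add[OF prod dI] by simp
qed

lemma continuous_on_cap_profile: "continuous_on {0..1} (cap_profile k)"
proof -
  have "continuous_on {0..1} (\<lambda>x. integral {x..1} (\<lambda>s. sqrt (1 - s\<^sup>2) ^ k))"
    by (rule indefinite_integral_continuous_1')
       (auto intro!: integrable_continuous_interval continuous_intros)
  then have "continuous_on {0..1} (\<lambda>t. integral {sqrt (1 - t)..1} (\<lambda>s. sqrt (1 - s\<^sup>2) ^ k))"
    by (rule continuous_on_compose2) (auto intro!: continuous_intros)
  then show ?thesis
    unfolding cap_profile_def[abs_def] by (intro continuous_intros) auto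
qed

lemma strict_mono_on_cap_profile:
  assumes "k \<ge> 1"
  shows "strict_mono_on {0..1} (cap_profile k)"
proof (rule strict_mono_onI)
  fix x y :: real
  assume xy: "x \<in> {0..1}" "y \<in> {0..1}" "x < y"
  show "cap_profile k x < cap_profile k y"
  proof (rule DERIV_pos_imp_increasing_open[OF xy(3)])
    fix t assume "x < t" "t < y"
    then have "0 < t" "t < 1" using xy by auto
    then show "\<exists>d. (cap_profile k has_real_derivative d) (at t) \<and> 0 < d"
      using cap_profile_has_real_derivative[OF assms, of t] assms by fastforce
  next
    show "continuous_on {x..y} (cap_profile k)"
      using continuous_on_subset[OF continuous_on_cap_profile] xy by auto
  qed
qed

lemma cap_profile_1_pos: "k \<ge> 1 \<Longrightarrow> 0 < cap_profile k 1"
  using strict_mono_onD[OF strict_mono_on_cap_profile, of k 0 1] by (simp add: cap_profile_0)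

text \<open>
  Both the beta integral and the cap volume are antiderivatives of the same function. The
  fundamental theorem is used in the form that needs the derivative only in the interior, because
  the integrand may blow up at the end points.
\<close>

lemma reg_inc_beta_eq_cap_profile:
  assumes k: "k \<ge> 1" and x: "x \<in> {0..1}"
  shows "reg_inc_beta x (k / 2) (1 / 2) = cap_profile k x / cap_profile k 1"
proof -
  let ?c = "k / (2 * (real k + 1))"
  have I: "integral {0..y} (\<lambda>t. t powr (k / 2 - 1) * (1 - t) powr (1 / 2 - 1)) = cap_profile k y / ?c"
    if y: "y \<in> {0..1}" for y
  proof -
    have "((\<lambda>t. ?c * (t powr (k / 2 - 1) * (1 - t) powr (1 / 2 - 1))) has_integral
             cap_profile k y - cap_profile k 0) {0..y}"
    proof (rule fundamental_theorem_of_calculus_interior)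
      show "continuous_on {0..y} (cap_profile k)"
        using continuous_on_subset[OF continuous_on_cap_profile] y by auto
      show "(cap_profile k has_vector_derivative
              ?c * (t powr (k / 2 - 1) * (1 - t) powr (1 / 2 - 1))) (at t)" if "t \<in> {0<..<y}" for t
        using cap_profile_has_real_derivative[OF k, of t] that y
        by (simp add: has_real_derivative_iff_has_vector_derivative)
    qed (use y in simp)
    from integral_unique[OF this]
    have "?c * integral {0..y} (\<lambda>t. t powr (k / 2 - 1) * (1 - t) powr (1 / 2 - 1)) = cap_profile k y"
      unfolding integral_mult_right cap_profile_0[OF k] by simp
    then show ?thesis
      using k by (simp only: eq_divide_eq) (simp add: mult.commute)
  qed
  have c: "?c \<noteq> 0" using k by simp
  show ?thesis
    unfolding reg_inc_beta_def I[OF x] using I[of 1] c by (simp add: divide_divide_eq_right)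
qed

text \<open>
  \<^const>\<open>zeta\<close> is the cosine of the opening angle at which a double cone fills the fraction
  \<open>2 * x\<close> of the ball; strict monotonicity makes that angle unique.
\<close>

lemma zeta_cap_profile:
  assumes n: "n \<ge> 2" and x: "0 \<le> x" "x < 1 / 2"
  shows "0 < zeta n x" "zeta n x \<le> 1"
    "cap_profile (n - 1) (1 - (zeta n x)\<^sup>2) = 2 * x * cap_profile (n - 1) 1"
proof -
  define k where "k = n - 1"
  have k: "k \<ge> 1" "real n - 1 = real k" using n by (auto simp: k_def)
  define F where "F = (\<lambda>x. reg_inc_beta x (k / 2) (1 / 2))"
  have F: "F y = cap_profile k y / cap_profile k 1" if "y \<in> {0..1}" for y
    using reg_inc_beta_eq_cap_profile[OF k(1) that] by (simp add: F_def)
  have mono: "strict_mono_on {0..1} F"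
    using strict_mono_on_cap_profile[OF k(1)] cap_profile_1_pos[OF k(1)]
    by (auto simp: strict_mono_on_def F divide_strict_right_mono)
  have inj: "inj_on F {0..1}"
    using mono by (rule strict_mono_on_imp_inj_on)
  have "continuous_on {0..1} F"
  proof (rule continuous_on_eq)
    show "continuous_on {0..1} (\<lambda>y. cap_profile k y / cap_profile k 1)"
      using cap_profile_1_pos[OF k(1)] by (intro continuous_intros continuous_on_cap_profile) auto
  qed (simp add: F)
  moreover have F01: "F 0 = 0" "F 1 = 1"
    using cap_profile_1_pos[OF k(1)] by (auto simp: F cap_profile_0[OF k(1)])
  ultimately obtain t where t: "0 \<le> t" "t \<le> 1" "F t = 2 * x"
    using IVT'[of F 0 "2 * x" 1] x by auto
  have "t \<noteq> 1" using t(3) F01 x by auto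
  have "the_inv_into {0..1} F (2 * x) = t"
    using inj t by (intro the_inv_into_f_eq) auto
  then have z: "zeta n x = sqrt (1 - t)"
    by (simp add: zeta_def inv_reg_inc_beta_def k(2) F_def)
  then show "0 < zeta n x" "zeta n x \<le> 1"
    using t \<open>t \<noteq> 1\<close> by auto
  have "1 - (zeta n x)\<^sup>2 = t"
    using z t by simp
  then show "cap_profile (n - 1) (1 - (zeta n x)\<^sup>2) = 2 * x * cap_profile (n - 1) 1"
    using F[of t] t cap_profile_1_pos[OF k(1)] by (simp only:) (simp add: k_def field_simps)
qed

section \<open>Volumes of axis-parallel double cones\<close>

text \<open>
  Radius of the slice at height \<^term>\<open>s\<close> of the unit ball intersected with the double cone of
  cosine \<^term>\<open>c\<close>: below height \<^term>\<open>c\<close> the cone is the binding constraint, above it the ball.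
  The strict comparison makes \<^term>\<open>c = 0\<close> describe the whole ball.
\<close>

definition cap_radius :: "real \<Rightarrow> real \<Rightarrow> real" where
  "cap_radius c s = (if \<bar>s\<bar> < c then \<bar>s\<bar> * sqrt (1 - c\<^sup>2) / c else sqrt (1 - s\<^sup>2))"

lemma le_cap_radius_iff:
  assumes c: "0 \<le> c" "c < 1" and \<rho>: "0 \<le> \<rho>"
  shows "s\<^sup>2 + \<rho>\<^sup>2 \<le> 1 \<and> c * sqrt (s\<^sup>2 + \<rho>\<^sup>2) \<le> \<bar>s\<bar> \<longleftrightarrow> \<bar>s\<bar> \<le> 1 \<and> \<rho> \<le> cap_radius c s"
proof -
  have c2: "c\<^sup>2 < 1" using c by (simp add: abs_square_less_1)
  have "c * sqrt (s\<^sup>2 + \<rho>\<^sup>2) \<le> \<bar>s\<bar> \<longleftrightarrow> (c * sqrt (s\<^sup>2 + \<rho>\<^sup>2))\<^sup>2 \<le> \<bar>s\<bar>\<^sup>2"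
    using c abs_le_square_iff[of "c * sqrt (s\<^sup>2 + \<rho>\<^sup>2)" s] by (simp add: abs_mult)
  then have cone: "c * sqrt (s\<^sup>2 + \<rho>\<^sup>2) \<le> \<bar>s\<bar> \<longleftrightarrow> c\<^sup>2 * \<rho>\<^sup>2 \<le> (1 - c\<^sup>2) * s\<^sup>2"
    by (simp add: power_mult_distrib algebra_simps)
  show ?thesis
  proof (cases "\<bar>s\<bar> < c")
    case True
    then have c0: "c > 0" by linarith
    have "\<rho> \<le> cap_radius c s \<longleftrightarrow> c * \<rho> \<le> sqrt (1 - c\<^sup>2) * \<bar>s\<bar>"
      using True c0 by (simp add: cap_radius_def field_simps)
    also have "\<dots> \<longleftrightarrow> (c * \<rho>)\<^sup>2 \<le> (sqrt (1 - c\<^sup>2) * \<bar>s\<bar>)\<^sup>2"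
      using c2 c \<rho> by (simp add: power2_le_iff_abs_le abs_mult)
    also have "\<dots> \<longleftrightarrow> c\<^sup>2 * \<rho>\<^sup>2 \<le> (1 - c\<^sup>2) * s\<^sup>2"
      using c2 by (simp add: power_mult_distrib)
    finally have rad: "\<rho> \<le> cap_radius c s \<longleftrightarrow> c\<^sup>2 * \<rho>\<^sup>2 \<le> (1 - c\<^sup>2) * s\<^sup>2" .
    have "s\<^sup>2 + \<rho>\<^sup>2 \<le> 1" if "c\<^sup>2 * \<rho>\<^sup>2 \<le> (1 - c\<^sup>2) * s\<^sup>2"
    proof -
      have "s\<^sup>2 \<le> c\<^sup>2" using True by (metis abs_le_square_iff abs_of_nonneg c(1) less_imp_le)
      then have "c\<^sup>2 * (s\<^sup>2 + \<rho>\<^sup>2) \<le> c\<^sup>2 * 1" using that by (simp add: algebra_simps)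
      then show ?thesis using c0 by (simp only: mult_le_cancel_left_pos zero_less_power)
    qed
    then show ?thesis using cone rad True c by auto
  next
    case False
    have "c\<^sup>2 * \<rho>\<^sup>2 \<le> (1 - c\<^sup>2) * s\<^sup>2" if "s\<^sup>2 + \<rho>\<^sup>2 \<le> 1"
    proof -
      have "c\<^sup>2 \<le> s\<^sup>2" using False c by (metis abs_le_square_iff abs_of_nonneg not_less)
      moreover have "c\<^sup>2 * \<rho>\<^sup>2 \<le> c\<^sup>2 * (1 - s\<^sup>2)" using that by (intro mult_left_mono) auto
      ultimately show ?thesis by (simp add: algebra_simps)
    qed
    moreover have "\<bar>s\<bar> \<le> 1 \<and> \<rho> \<le> sqrt (1 - s\<^sup>2) \<longleftrightarrow> s\<^sup>2 + \<rho>\<^sup>2 \<le> 1"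
    proof
      assume *: "s\<^sup>2 + \<rho>\<^sup>2 \<le> 1"
      then have "s\<^sup>2 \<le> 1" using zero_le_power2[of \<rho>] by linarith
      then show "\<bar>s\<bar> \<le> 1 \<and> \<rho> \<le> sqrt (1 - s\<^sup>2)"
        using * by (auto simp: abs_square_le_1 intro!: real_le_rsqrt)
    next
      assume *: "\<bar>s\<bar> \<le> 1 \<and> \<rho> \<le> sqrt (1 - s\<^sup>2)"
      then have "\<rho>\<^sup>2 \<le> (sqrt (1 - s\<^sup>2))\<^sup>2" using \<rho> by (intro power_mono) auto
      then show "s\<^sup>2 + \<rho>\<^sup>2 \<le> 1" using * by (simp add: abs_square_le_1)
    qed
    ultimately show ?thesis using cone False by (auto simp: cap_radius_def)
  qed
qed

lemma has_integral_cap_radius: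
  assumes c: "0 \<le> c" "c < 1" and k: "k \<ge> 1"
  shows "((\<lambda>s. cap_radius c s ^ k) has_integral 2 * cap_profile k (1 - c\<^sup>2)) {-1..1}"
proof -
  let ?q = "sqrt (1 - c\<^sup>2)"
  have inner: "((\<lambda>s. cap_radius c s ^ k) has_integral c * ?q ^ k / (real k + 1)) {0..c}"
  proof (cases "c = 0")
    case False
    have I: "((\<lambda>s. (?q / c) ^ k * s ^ k) has_integral
        (?q / c) ^ k * (c ^ Suc k / (real k + 1)) - (?q / c) ^ k * (0 ^ Suc k / (real k + 1))) {0..c}"
    proof (rule fundamental_theorem_of_calculus[OF c(1)])
      fix x :: real
      have "((\<lambda>s. (?q / c) ^ k * (s ^ Suc k / (real k + 1))) has_real_derivative
          (?q / c) ^ k * ((real k + 1) * x ^ k / (real k + 1))) (at x within {0..c})"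
        using DERIV_pow[of "Suc k" x "{0..c}"]
        by (intro DERIV_cmult DERIV_cdivide) (simp add: add.commute)
      then show "((\<lambda>s. (?q / c) ^ k * (s ^ Suc k / (real k + 1))) has_vector_derivative
          (?q / c) ^ k * x ^ k) (at x within {0..c})"
        by (simp add: has_real_derivative_iff_has_vector_derivative del: power_Suc)
    qed
    have eq: "(?q / c) ^ k * (c ^ Suc k / (real k + 1)) = c * ?q ^ k / (real k + 1)"
      using False by (simp add: power_divide)
    have "((\<lambda>s. (?q / c) ^ k * s ^ k) has_integral c * ?q ^ k / (real k + 1)) {0..c}"
      using I unfolding eq by simp
    then show ?thesis
      by (rule has_integral_eq[rotated])
         (use False in \<open>auto simp: cap_radius_def power_mult_distrib power_divide\<close>)
  qed (use has_integral_null_real[of 0 0] in simp)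
  have outer: "((\<lambda>s. cap_radius c s ^ k) has_integral integral {c..1} (\<lambda>s. sqrt (1 - s\<^sup>2) ^ k)) {c..1}"
  proof (rule has_integral_eq[rotated])
    show "((\<lambda>s. sqrt (1 - s\<^sup>2) ^ k) has_integral integral {c..1} (\<lambda>s. sqrt (1 - s\<^sup>2) ^ k)) {c..1}"
      by (intro integrable_integral integrable_continuous_interval continuous_intros)
  qed (use c in \<open>auto simp: cap_radius_def\<close>)
  have half: "((\<lambda>s. cap_radius c s ^ k) has_integral cap_profile k (1 - c\<^sup>2)) {0..1}"
    using has_integral_combine[OF _ _ inner outer] c by (simp add: cap_profile_def)
  then have "((\<lambda>s. cap_radius c (- s) ^ k) has_integral cap_profile k (1 - c\<^sup>2)) {-1..-0}"
    by (subst has_integral_reflect_real)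
  moreover have "cap_radius c (- s) = cap_radius c s" for s
    by (simp add: cap_radius_def)
  ultimately have "((\<lambda>s. cap_radius c s ^ k) has_integral cap_profile k (1 - c\<^sup>2)) {-1..0}"
    by simp
  from has_integral_combine[OF _ _ this half] show ?thesis by simp
qed

text \<open>
  Fubini in the coordinate along the axis: each slice is a ball of radius \<^const>\<open>cap_radius\<close>
  in the remaining \<open>k\<close> coordinates.
\<close>

lemma emeasure_axis_double_cone:
  fixes e :: "'a::euclidean_space"
  assumes e: "e \<in> Basis" and c: "0 \<le> c" "c < 1" and k: "DIM('a) = Suc k" "k \<ge> 1"
  shows "emeasure lborel {x \<in> cball 0 1. c * norm x \<le> \<bar>x \<bullet> e\<bar>} =
    ennreal (unit_ball_vol k * (2 * cap_profile k (1 - c\<^sup>2)))"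
proof -
  interpret product_sigma_finite "\<lambda>_::'a. lborel :: real measure"
    by standard
  define A where "A = Basis - {e}"
  have A: "finite A" "e \<notin> A" "Basis = insert e A" "card A = k"
    using e k by (auto simp: A_def)
  define M where "M = (\<lambda>B::'a set. Pi\<^sub>M B (\<lambda>_. lborel :: real measure))"
  define nsq where "nsq f = (\<Sum>b\<in>A. (f b)\<^sup>2)" for f :: "'a \<Rightarrow> real"
  define K where "K = {f. (f e)\<^sup>2 + nsq f \<le> 1 \<and> c * sqrt ((f e)\<^sup>2 + nsq f) \<le> \<bar>f e\<bar>}"
  let ?S = "{x \<in> cball 0 1. c * norm x \<le> \<bar>x \<bullet> e\<bar>}"
  have nsq0: "0 \<le> nsq f" for f by (simp add: nsq_def sum_nonneg)
  have meas: "?S \<in> sets borel" by measurable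
  have norm: "norm (\<Sum>b\<in>Basis. f b *\<^sub>R b :: 'a) = sqrt ((f e)\<^sup>2 + nsq f)" for f
  proof -
    have "norm (\<Sum>b\<in>Basis. f b *\<^sub>R b :: 'a) = dist 0 (\<Sum>b\<in>Basis. f b *\<^sub>R b :: 'a)"
      by simp
    also have "\<dots> = sqrt (\<Sum>b\<in>Basis. (f b)\<^sup>2)"
      by (subst euclidean_dist_l2) (auto simp: L2_set_def)
    also have "\<dots> = sqrt ((f e)\<^sup>2 + nsq f)"
      unfolding A(3) nsq_def using A(1,2) by simp
    finally show ?thesis .
  qed
  have K_eq: "{f. (\<Sum>b\<in>Basis. f b *\<^sub>R b) \<in> ?S} = K"
    using e by (auto simp: K_def norm)
  have K_meas: "K \<inter> space (M (insert e A)) \<in> sets (M (insert e A))"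
  proof -
    have comp: "(\<lambda>f. f b) \<in> borel_measurable (M (insert e A))" if "b \<in> insert e A" for b
      unfolding M_def using measurable_component_singleton[OF that, of "\<lambda>_. lborel"] by simp
    have "(\<lambda>f. (f e)\<^sup>2 + nsq f) \<in> borel_measurable (M (insert e A))"
      unfolding nsq_def[abs_def]
      by (intro borel_measurable_add borel_measurable_sum borel_measurable_power comp) auto
    note meas = borel_measurable_le[OF this borel_measurable_const]
      borel_measurable_le[OF borel_measurable_times[OF borel_measurable_const measurable_compose[OF this borel_measurable_sqrt]]
        borel_measurable_abs[OF comp[of e]]]
    have "K \<inter> space (M (insert e A)) = {f \<in> space (M (insert e A)).
        (f e)\<^sup>2 + nsq f \<le> 1 \<and> c * sqrt ((f e)\<^sup>2 + nsq f) \<le> \<bar>f e\<bar>}"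
      by (auto simp: K_def)
    moreover have "\<dots> \<in> sets (M (insert e A))"
      by (intro sets.sets_Collect_conj meas) simp
    ultimately show ?thesis by simp
  qed
  have "emeasure lborel ?S = emeasure (M Basis) (K \<inter> space (M Basis))"
    unfolding M_def K_eq[symmetric] using meas
    by (subst lborel_eq, subst emeasure_distr) (auto simp: vimage_def)
  also have "\<dots> = (\<integral>\<^sup>+f. indicator (K \<inter> space (M (insert e A))) f \<partial>M (insert e A))"
    using K_meas by (simp add: A(3))
  also have "\<dots> = (\<integral>\<^sup>+s. \<integral>\<^sup>+f. indicator (K \<inter> space (M (insert e A))) (f(e := s)) \<partial>M A \<partial>lborel)"
    using A K_meas unfolding M_def by (subst product_nn_integral_insert_rev) auto
  also have "\<dots> = (\<integral>\<^sup>+s. \<integral>\<^sup>+f. indicator {-1..1} s *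
      indicator ({f. sqrt (nsq f) \<le> cap_radius c s} \<inter> space (M A)) f \<partial>M A \<partial>lborel)"
  proof (intro nn_integral_cong)
    fix s and f :: "'a \<Rightarrow> real" assume f: "f \<in> space (M A)"
    have "nsq (f(e := s)) = nsq f"
      unfolding nsq_def using A by (intro sum.cong) auto
    then have "f(e := s) \<in> K \<longleftrightarrow> \<bar>s\<bar> \<le> 1 \<and> sqrt (nsq f) \<le> cap_radius c s"
      using le_cap_radius_iff[OF c, of "sqrt (nsq f)" s] nsq0[of f] by (simp add: K_def)
    moreover have "f(e := s) \<in> space (M (insert e A))"
      using f by (auto simp: M_def space_PiM PiE_def extensional_def)
    ultimately show "(indicator (K \<inter> space (M (insert e A))) (f(e := s)) :: ennreal) =
      indicator {-1..1} s * indicator ({f. sqrt (nsq f) \<le> cap_radius c s} \<inter> space (M A)) f"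
      using f by (auto simp: indicator_def abs_le_iff)
  qed
  also have "\<dots> = (\<integral>\<^sup>+s. indicator {-1..1} s *
      emeasure (M A) ({f. sqrt (nsq f) \<le> cap_radius c s} \<inter> space (M A)) \<partial>lborel)"
    unfolding M_def nsq_def by (subst nn_integral_cmult) auto
  also have "\<dots> = (\<integral>\<^sup>+s. indicator {-1..1} s *
      ennreal (unit_ball_vol k * cap_radius c s ^ k) \<partial>lborel)"
  proof (intro nn_integral_cong_AE)
    (* These are the heights at which a slice may degenerate to a point. *)
    have "AE s in lborel. s \<notin> {-1, 0, 1::real}"
      by (intro AE_not_in countable_imp_null_set_lborel) auto
    then show "AE s in lborel. indicator {-1..1} s *
        emeasure (M A) ({f. sqrt (nsq f) \<le> cap_radius c s} \<inter> space (M A)) =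
        indicator {-1..1} s * ennreal (unit_ball_vol k * cap_radius c s ^ k)"
    proof eventually_elim
      case (elim s)
      show ?case
      proof (cases "s \<in> {-1..1}")
        case True
        with elim have "0 < cap_radius c s"
          using c by (auto simp: cap_radius_def abs_square_less_1)
        then show ?thesis
          using emeasure_cball_aux[OF A(1), of "cap_radius c s"] by (simp add: M_def nsq_def A(4))
      qed simp
    qed
  qed
  also have "\<dots> = (\<integral>\<^sup>+s. ennreal (unit_ball_vol k * cap_radius c s ^ k) * indicator {-1..1} s \<partial>lborel)"
    by (simp add: mult.commute)
  also have "\<dots> = ennreal (unit_ball_vol k * (2 * cap_profile k (1 - c\<^sup>2)))"
  proof (rule nn_integral_has_integral_lebesgue')
    show "((\<lambda>s. unit_ball_vol k * cap_radius c s ^ k) has_integral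
        unit_ball_vol k * (2 * cap_profile k (1 - c\<^sup>2))) {-1..1}"
      by (intro has_integral_mult_right has_integral_cap_radius c k)
    fix s :: real assume "s \<in> {-1..1}"
    then show "0 \<le> unit_ball_vol k * cap_radius c s ^ k"
      using c by (auto simp: cap_radius_def abs_square_le_1 abs_le_iff
          intro!: mult_nonneg_nonneg zero_le_power divide_nonneg_nonneg)
  qed
  finally show ?thesis .
qed

section \<open>Linear changes of variables\<close>

text \<open>
  A copy of a finite type, ordered along an injection into the natural numbers. That a matrix
  scales volumes by its determinant is proved by row operations along an order of the indices;
  renaming the indices into a well-ordered copy carries the formula over to arbitrary finite index
  types.
\<close>

datatype 'a wo_copy = Wo_Copy (wo_orig: 'a)

lemma bij_wo_orig: "bij wo_orig"
  by (rule bij_betw_byWitness[where f' = Wo_Copy]) auto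

instance wo_copy :: (finite) finite
proof
  have "(UNIV :: 'a wo_copy set) = range Wo_Copy"
    by (metis surj_def wo_copy.collapse)
  then show "finite (UNIV :: 'a wo_copy set)"
    by (metis finite_imageI finite_class.finite_UNIV)
qed

instantiation wo_copy :: (finite) wellorder
begin

definition less_eq_wo_copy :: "'a wo_copy \<Rightarrow> 'a wo_copy \<Rightarrow> bool" where
  "x \<le> y \<longleftrightarrow> to_nat (wo_orig x) \<le> to_nat (wo_orig y)"

definition less_wo_copy :: "'a wo_copy \<Rightarrow> 'a wo_copy \<Rightarrow> bool" where
  "x < y \<longleftrightarrow> to_nat (wo_orig x) < to_nat (wo_orig y)"

instance
proof
  fix P :: "'a wo_copy \<Rightarrow> bool" and a :: "'a wo_copy"
  assume step: "\<And>x. (\<And>y. y < x \<Longrightarrow> P y) \<Longrightarrow> P x"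
  show "P a"
    by (induction a rule: measure_induct_rule[of "\<lambda>x. to_nat (wo_orig x)"])
       (auto intro: step simp: less_wo_copy_def)
qed (auto simp: less_eq_wo_copy_def less_wo_copy_def wo_copy.expand)

end

text \<open>
  Conjugation with the bijection matches the permutations in the two Leibniz expansions and
  preserves signs.
\<close>

lemma det_reindex:
  fixes M :: "real^'n^'n" and h :: "'m::finite \<Rightarrow> 'n"
  assumes h: "bij h"
  shows "det (\<chi> i j. M $ h i $ h j :: real^'m^'m) = det M"
proof -
  define \<phi> where "\<phi> = map_permutation (UNIV::'m set) h"
  define \<psi> where "\<psi> = map_permutation (UNIV::'n set) (inv h)"
  have inj: "inj h" using h by (rule bij_is_inj)
  have \<phi>_apply: "\<phi> p (h i) = h (p i)" for p i
    unfolding \<phi>_def using inj by (rule map_permutation_apply) simp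
  have sgn: "sign (\<phi> p) = sign p" if "p permutes UNIV" for p
    unfolding \<phi>_def using that inj by (intro sign_map_permutation) auto
  have "det M = (\<Sum>p | p permutes UNIV. of_int (sign p) * (\<Prod>i\<in>UNIV. M $ h i $ h (p i)))"
    unfolding det_def
  proof (rule sum.reindex_bij_witness[where i = \<phi> and j = \<psi>])
    fix p :: "'n \<Rightarrow> 'n" assume "p \<in> {p. p permutes UNIV}"
    then have p: "p permutes UNIV" by simp
    show \<phi>\<psi>: "\<phi> (\<psi> p) = p"
      unfolding \<phi>_def \<psi>_def
      using h p by (intro map_permutation_compose_inv) (auto simp: bij_imp_bij_inv bij_is_surj surj_f_inv_f)
    show \<psi>p: "\<psi> p \<in> {p. p permutes UNIV}"
      unfolding \<psi>_def using h p by (auto intro!: map_permutation_permutes bij_imp_bij_inv)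
    have "(\<Prod>i\<in>UNIV. M $ i $ p i) = (\<Prod>i\<in>UNIV. M $ h i $ p (h i))"
      using h by (intro prod.reindex_bij_betw[symmetric])
    also have "\<dots> = (\<Prod>i\<in>UNIV. M $ h i $ h (\<psi> p i))"
      using \<phi>_apply[of "\<psi> p"] by (simp add: \<phi>\<psi>)
    finally show "of_int (sign (\<psi> p)) * (\<Prod>i\<in>UNIV. M $ h i $ h (\<psi> p i)) =
        of_int (sign p) * (\<Prod>i\<in>UNIV. M $ i $ p i)"
      using sgn[of "\<psi> p"] \<psi>p by (simp add: \<phi>\<psi>)
  next
    fix p :: "'m \<Rightarrow> 'm" assume "p \<in> {p. p permutes UNIV}"
    then have p: "p permutes UNIV" by simp
    show "\<psi> (\<phi> p) = p"
      unfolding \<phi>_def \<psi>_def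
      using h p inj by (intro map_permutation_compose_inv) auto
    show "\<phi> p \<in> {p. p permutes UNIV}"
      unfolding \<phi>_def using h p by (auto intro!: map_permutation_permutes)
  qed
  then show ?thesis by (simp add: det_def)
qed

lemma linear_reindex: "linear (\<lambda>x::real^'n. \<chi> i::'m::finite. x $ h i)"
  by (intro linearI) (auto simp: vec_eq_iff)

lemma borel_measurable_linear:
  fixes f :: "'a::euclidean_space \<Rightarrow> 'b::euclidean_space"
  shows "linear f \<Longrightarrow> f \<in> borel_measurable borel"
  by (intro borel_measurable_continuous_onI linear_continuous_on) (simp add: linear_linear)

text \<open>
  Renaming coordinates maps boxes to boxes with the same side lengths.
\<close>

lemma lborel_distr_reindex:
  fixes h :: "'m::finite \<Rightarrow> 'n::finite"
  assumes h: "bij h"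
  shows "distr lborel borel (\<lambda>x::real^'n. \<chi> i. x $ h i) = (lborel :: (real^'m) measure)"
proof (rule lborel_eqI[symmetric])
  fix l u :: "real^'m"
  assume "\<And>b. b \<in> Basis \<Longrightarrow> l \<bullet> b \<le> u \<bullet> b"
  then have lu: "l $ i \<le> u $ i" for i
    by (metis axis_in_Basis_iff cart_eq_inner_axis real_inner_1_right Basis_real_def singletonI)
  define pull :: "real^'m \<Rightarrow> real^'n" where "pull x = (\<chi> j. x $ inv h j)" for x
  have inv: "inv h (h i) = i" "h (inv h j) = j" for i j
    using h by (simp_all add: bij_is_inj bij_is_surj surj_f_inv_f)
  have box: "(\<lambda>x::real^'n. \<chi> i. x $ h i) -` box l u = box (pull l) (pull u)"
    by (auto simp: mem_box_cart pull_def) (metis inv)+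
  have prod: "(\<Prod>b\<in>Basis. (u - l) \<bullet> b) = (\<Prod>i\<in>UNIV. u $ i - l $ i)" for l u :: "real^'k::finite"
    by (simp add: Basis_vec_def inner_axis UNION_singleton_eq_range prod.reindex inj_on_def axis_eq_axis)
  have "emeasure (distr lborel borel (\<lambda>x::real^'n. \<chi> i. x $ h i)) (box l u) =
      emeasure lborel (box (pull l) (pull u))"
    using borel_measurable_linear[OF linear_reindex[of h]]
    by (subst emeasure_distr) (auto simp: box)
  also have "\<dots> = (\<Prod>b\<in>Basis. (pull u - pull l) \<bullet> b)"
    by (rule emeasure_lborel_box)
       (auto simp: Basis_vec_def inner_axis pull_def lu)
  also have "(\<Prod>b\<in>Basis. (pull u - pull l) \<bullet> b) = (\<Prod>j\<in>UNIV. u $ inv h j - l $ inv h j)"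
    by (simp add: prod) (simp add: pull_def)
  also have "\<dots> = (\<Prod>i\<in>UNIV. u $ i - l $ i)"
    using bij_imp_bij_inv[OF h] by (rule prod.reindex_bij_betw)
  also have "\<dots> = (\<Prod>b\<in>Basis. (u - l) \<bullet> b)"
    by (simp add: prod)
  finally show "emeasure (distr lborel borel (\<lambda>x::real^'n. \<chi> i. x $ h i)) (box l u) =
      ennreal (\<Prod>b\<in>Basis. (u - l) \<bullet> b)" .
qed simp

lemma fmeasurable_lborel_bounded: "S \<in> sets borel \<Longrightarrow> bounded S \<Longrightarrow> S \<in> fmeasurable lborel"
  using emeasure_bounded_finite by (intro fmeasurableI) auto

lemma inverse_matrix:
  fixes L :: "real^'n^'n"
  assumes L: "det L \<noteq> 0"
  obtains K where "L ** K = mat 1" "K ** L = mat 1" "det K = 1 / det L"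
    "\<And>S. (*v) L -` S = (*v) K ` S"
proof -
  obtain K where K: "L ** K = mat 1" "K ** L = mat 1"
    using L by (auto simp: invertible_det_nz[symmetric] invertible_def)
  have "det K * det L = 1"
    using K(2) by (simp add: det_mul[symmetric])
  then have det: "det K = 1 / det L"
    using L by (simp add: field_simps)
  have inv: "L *v (K *v x) = x" "K *v (L *v x) = x" for x
    by (simp_all add: matrix_vector_mul_assoc K)
  have "x \<in> (*v) K ` S" if "L *v x \<in> S" for x S
    using imageI[OF that, of "(*v) K"] by (simp add: inv)
  then have "(*v) L -` S = (*v) K ` S" for S
    by (auto simp: inv)
  with K det show thesis by (rule that)
qed

text \<open>
  Stated with preimages rather than images, because preimages of Borel sets are Borel.
\<close>

lemma vimage_matrix_measure_wellorder:
  fixes L :: "real^'n::{finite,wellorder}^'n::_"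
  assumes L: "det L \<noteq> 0" and S: "S \<in> sets borel" "bounded S"
  shows "measure lborel ((*v) L -` S) = measure lborel S / \<bar>det L\<bar>"
proof -
  obtain K where K: "det K = 1 / det L" "\<And>S. (*v) L -` S = (*v) K ` S"
    using inverse_matrix[OF L] by metis
  have "S \<in> lmeasurable"
    using S by (intro bounded_set_imp_lmeasurable) auto
  then have "measure lebesgue ((*v) K ` S) =
      \<bar>det (matrix ((*v) K))\<bar> * measure lebesgue S"
    by (intro measure_linear_image) auto
  moreover have "(*v) L -` S \<in> sets borel"
    using measurable_sets[OF borel_measurable_linear S(1), of "(*v) L"] by simp
  ultimately show ?thesis
    using S by (simp add: K abs_divide)
qed

lemma vimage_matrix_measure:
  fixes L :: "real^'n^'n"
  assumes L: "det L \<noteq> 0" and S: "S \<in> sets borel" "bounded S"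
  shows "(*v) L -` S \<in> fmeasurable lborel"
    and "measure lborel ((*v) L -` S) = measure lborel S / \<bar>det L\<bar>"
proof -
  have SL: "(*v) L -` S \<in> sets borel"
    using measurable_sets[OF borel_measurable_linear S(1), of "(*v) L"] by simp
  obtain K where "\<And>S. (*v) L -` S = (*v) K ` S"
    using inverse_matrix[OF L] by metis
  then have "bounded ((*v) L -` S)"
    using S(2) unfolding \<open>(*v) L -` S = (*v) K ` S\<close>
    by (simp add: bounded_linear_image linear_linear)
  with SL show "(*v) L -` S \<in> fmeasurable lborel"
    by (rule fmeasurable_lborel_bounded)
  define \<phi> :: "real^'n \<Rightarrow> real^'n wo_copy" where "\<phi> x = (\<chi> i. x $ wo_orig i)" for x
  define \<psi> :: "real^'n wo_copy \<Rightarrow> real^'n" where "\<psi> x = (\<chi> i. x $ Wo_Copy i)" for x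
  have lin: "linear \<phi>" "linear \<psi>"
    unfolding \<phi>_def \<psi>_def by (rule linear_reindex)+
  have \<phi>: "\<phi> \<in> borel_measurable borel" and \<psi>: "\<psi> \<in> borel_measurable borel"
    using lin by (simp_all add: borel_measurable_linear)
  have inv: "\<psi> (\<phi> x) = x" "\<phi> (\<psi> y) = y" for x y
    by (simp_all add: \<phi>_def \<psi>_def vec_eq_iff)
  have pres: "measure lborel (\<phi> -` T) = measure lborel T" if "T \<in> sets borel" for T
  proof -
    have "lborel = distr lborel borel \<phi>"
      unfolding \<phi>_def lborel_distr_reindex[OF bij_wo_orig] ..
    then have "measure lborel T = measure (distr lborel borel \<phi>) T"
      by simp
    then show ?thesis
      using that \<phi> by (simp add: measure_distr)
  qed
  define L' :: "real^'n wo_copy^'n wo_copy" where "L' = (\<chi> i j. L $ wo_orig i $ wo_orig j)"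
  have det: "det L' = det L"
    unfolding L'_def by (rule det_reindex[OF bij_wo_orig])
  have L': "\<phi> (L *v x) = L' *v \<phi> x" for x
    by (simp add: \<phi>_def L'_def vec_eq_iff matrix_vector_mult_def)
      (intro allI sum.reindex_bij_betw[symmetric] bij_wo_orig)
  define S' where "S' = \<psi> -` S"
  have S': "S' \<in> sets borel" "S = \<phi> -` S'"
    using measurable_sets[OF \<psi> S(1)] by (auto simp: S'_def inv)
  have "S' = \<phi> ` S"
    by (force simp: S'_def inv)
  then have bS': "bounded S'"
    using S(2) lin by (auto intro!: bounded_linear_image simp: linear_linear)
  have SL': "(*v) L' -` S' \<in> sets borel"
    using measurable_sets[OF borel_measurable_linear S'(1), of "(*v) L'"] by simp
  have "(*v) L -` S = \<phi> -` ((*v) L' -` S')"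
    by (auto simp: S'(2) L')
  then have "measure lborel ((*v) L -` S) = measure lborel ((*v) L' -` S')"
    using pres[OF SL'] by simp
  also have "\<dots> = measure lborel S' / \<bar>det L\<bar>"
    using vimage_matrix_measure_wellorder[of L' S'] L det S'(1) bS' by simp
  also have "measure lborel S' = measure lborel S"
    using pres[OF S'(1)] S'(2) by simp
  finally show "measure lborel ((*v) L -` S) = measure lborel S / \<bar>det L\<bar>" .
qed

section \<open>Cone measures on the sphere\<close>
text \<open>
  The open ball is used to match the cone measure; the apex is removed because the bad cones
  below do not contain it. Neither choice affects the volume.
\<close>

definition double_cone :: "real^'n \<Rightarrow> real \<Rightarrow> (real^'n) set" where
  "double_cone v c = {x \<in> ball 0 1 - {0}. c * norm x \<le> \<bar>v \<bullet> x\<bar>}"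

lemma borel_double_cone: "double_cone v c \<in> sets borel"
proof -
  have "{x. c * norm x \<le> \<bar>v \<bullet> x\<bar>} \<in> sets borel"
    by (intro borel_closed closed_Collect_le continuous_intros)
  then have "(ball 0 1 - {0}) \<inter> {x. c * norm x \<le> \<bar>v \<bullet> x\<bar>} \<in> sets borel"
    by (intro sets.Int sets.Diff) auto
  moreover have "double_cone v c = (ball 0 1 - {0}) \<inter> {x. c * norm x \<le> \<bar>v \<bullet> x\<bar>}"
    by (auto simp: double_cone_def)
  ultimately show ?thesis by simp
qed

lemma bounded_double_cone: "bounded (double_cone v c)"
  by (rule bounded_subset[OF bounded_ball[of 0 1]]) (auto simp: double_cone_def)

lemma measure_double_cone_cball:
  "measure lborel (double_cone v c) = measure lborel {x \<in> cball 0 1. c * norm x \<le> \<bar>v \<bullet> x\<bar>}"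
proof -
  let ?C = "{x \<in> cball 0 1. c * norm x \<le> \<bar>v \<bullet> x\<bar>}"
  have C: "?C \<in> sets borel"
  proof -
    have "closed (cball 0 1 \<inter> {x. c * norm x \<le> \<bar>v \<bullet> x\<bar>})"
      by (intro closed_Int closed_cball closed_Collect_le continuous_intros)
    moreover have "?C = cball 0 1 \<inter> {x. c * norm x \<le> \<bar>v \<bullet> x\<bar>}"
      by auto
    ultimately show ?thesis by simp
  qed
  have "negligible (sphere (0::real^'n) 1 \<union> {0})"
    by (intro negligible_Un negligible_sphere negligible_sing)
  then have "negligible ((?C - double_cone v c) \<union> (double_cone v c - ?C))"
    by (rule negligible_subset) (auto simp: double_cone_def)
  moreover have "?C \<in> lmeasurable"
    using C by (intro bounded_set_imp_lmeasurable bounded_subset[OF bounded_cball[of 0 1]]) auto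
  ultimately have "measure lebesgue (double_cone v c) = measure lebesgue ?C"
    by (intro measure_negligible_symdiff)
  moreover have "measure lebesgue (double_cone v c) = measure lborel (double_cone v c)"
    using borel_double_cone by (intro measure_completion) simp
  moreover have "measure lebesgue ?C = measure lborel ?C"
    using C by (intro measure_completion) simp
  ultimately show ?thesis by simp
qed

text \<open>
  An orthogonal map takes the axis to a coordinate axis and preserves volume.
\<close>

lemma measure_double_cone:
  fixes v :: "real^'n"
  assumes v: "norm v = 1" and c: "0 \<le> c" "c < 1" and k: "CARD('n) = Suc k" "k \<ge> 1"
  shows "measure lborel (double_cone v c) = unit_ball_vol k * (2 * cap_profile k (1 - c\<^sup>2))"
proof -
  define e :: "real^'n" where "e = axis undefined 1"
  have e: "e \<in> Basis" "norm e = 1"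
    by (auto simp: e_def axis_in_Basis_iff norm_axis_1)
  obtain f where f: "orthogonal_transformation f" "f v = e"
    using orthogonal_transformation_exists[of v e] v e by metis
  define M where "M = matrix f"
  have Mf: "f = (*v) M"
    using f(1) by (auto simp: M_def orthogonal_transformation_linear matrix_works)
  have "\<bar>det M\<bar> = 1"
    using f(1) by (metis M_def orthogonal_transformation_matrix det_orthogonal_matrix abs_1 abs_minus_cancel)
  moreover have "(*v) M -` double_cone e c = double_cone v c"
  proof -
    have "norm (f x) = norm x" "f v \<bullet> f x = v \<bullet> x" for x
      using f(1) by (simp_all add: orthogonal_transformation_norm orthogonal_transformation_def)
    moreover from this(1) have "f x = 0 \<longleftrightarrow> x = 0" for x
      by (metis norm_eq_zero)
    ultimately show ?thesis
      unfolding Mf[symmetric] by (auto simp: double_cone_def f(2)[symmetric])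
  qed
  ultimately have "measure lborel (double_cone v c) = measure lborel (double_cone e c)"
    using vimage_matrix_measure(2)[of M, OF _ borel_double_cone bounded_double_cone, of e c]
    by (metis abs_0 div_by_1 zero_neq_one)
  also have "\<dots> = measure lborel {x \<in> cball 0 1. c * norm x \<le> \<bar>x \<bullet> e\<bar>}"
    by (simp add: measure_double_cone_cball inner_commute)
  also have "\<dots> = unit_ball_vol k * (2 * cap_profile k (1 - c\<^sup>2))"
  proof -
    have "c\<^sup>2 \<le> 1" using c by (simp add: abs_square_le_1)
    then have "cap_profile k 0 \<le> cap_profile k (1 - c\<^sup>2)"
      using strict_mono_on_leD[OF strict_mono_on_cap_profile[OF k(2)]] by simp
    then have "0 \<le> cap_profile k (1 - c\<^sup>2)"
      using cap_profile_0[OF k(2)] by simp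
    then show ?thesis
      using emeasure_axis_double_cone[OF e(1) c _ k(2)] k(1) by (simp add: measure_def)
  qed
  finally show ?thesis .
qed

lemma measure_unit_ball:
  assumes k: "CARD('n) = Suc k" "k \<ge> 1"
  shows "measure lborel (ball (0::real^'n) 1) = unit_ball_vol k * (2 * cap_profile k 1)"
proof -
  obtain v :: "real^'n" where v: "norm v = 1"
    using vector_choose_size[of 1, where 'a="real^'n"] by auto
  have "measure lborel (ball (0::real^'n) 1) = measure lborel (cball (0::real^'n) 1)"
    by (simp add: content_ball content_cball)
  also have "\<dots> = measure lborel (double_cone v 0)"
    by (simp add: measure_double_cone_cball cball_def)
  also have "\<dots> = unit_ball_vol k * (2 * cap_profile k 1)"
    using measure_double_cone[OF v _ _ k, of 0] by simp
  finally show ?thesis .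
qed

text \<open>
  This is the definition of the cone measure read for a set that is itself a cone.
\<close>

lemma measure_uniform_sphere_cone:
  fixes K :: "'a::euclidean_space set"
  assumes K: "K \<in> sets borel" and cone: "\<And>x. x \<noteq> 0 \<Longrightarrow> sgn x \<in> K \<longleftrightarrow> x \<in> K" and "0 \<notin> K"
  shows "measure uniform_sphere (K \<inter> sphere 0 1) * measure lborel (ball (0::'a) 1) =
    measure lborel (K \<inter> ball 0 1)"
proof -
  interpret prob_space "uniform_sphere :: 'a measure"
    by (rule prob_space_uniform_sphere)
  have "K \<inter> sphere 0 1 \<in> sets uniform_sphere"
    using K by (auto simp: sets_uniform_sphere sets_restrict_space_iff)
  moreover have "{x \<in> ball 0 1. sgn x \<in> K \<inter> sphere 0 1} = K \<inter> ball 0 1"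
  proof -
    have "sgn x \<in> K \<inter> sphere 0 1 \<longleftrightarrow> x \<in> K" for x
      using cone[of x] \<open>0 \<notin> K\<close> by (cases "x = 0") (auto simp: norm_sgn)
    then show ?thesis by auto
  qed
  ultimately have "emeasure uniform_sphere (K \<inter> sphere 0 1) =
      emeasure lborel (K \<inter> ball 0 1) / emeasure lborel (ball (0::'a) 1)"
    using emeasure_uniform_sphere[of "K \<inter> sphere 0 1"] by simp
  moreover have "emeasure lborel (K \<inter> ball 0 1) = ennreal (measure lborel (K \<inter> ball 0 1))"
    using emeasure_bounded_finite[of "K \<inter> ball 0 1"]
    by (intro emeasure_eq_ennreal_measure) (auto simp: bounded_Int)
  moreover have "emeasure lborel (ball (0::'a) 1) = ennreal (measure lborel (ball (0::'a) 1))"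
    using emeasure_bounded_finite[OF bounded_ball[of "0::'a" 1]]
    by (intro emeasure_eq_ennreal_measure) auto
  moreover have pos: "0 < measure lborel (ball (0::'a) 1)"
    by (simp add: content_ball)
  ultimately have "measure uniform_sphere (K \<inter> sphere 0 1) =
      measure lborel (K \<inter> ball 0 1) / measure lborel (ball (0::'a) 1)"
    by (simp add: emeasure_eq_measure divide_ennreal)
  then show ?thesis
    using pos by (simp add: field_simps)
qed

section \<open>Gain bounds from few bad directions\<close>
lemma quad_norm_eq_norm:
  assumes "transpose L ** L = P"
  shows "quad_norm P x = norm (L *v x)"
proof -
  have "x \<bullet> (P *v x) = (L *v x) \<bullet> (L *v x)"
    unfolding assms[symmetric]
    by (metis matrix_vector_mul_assoc dot_lmul_matrix transpose_matrix_vector transpose_transpose)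
  then show ?thesis
    by (simp add: quad_norm_def norm_eq_sqrt_inner)
qed

lemma quad_norm_scaleR: "quad_norm P (a *\<^sub>R x) = \<bar>a\<bar> * quad_norm P x"
  by (simp add: quad_norm_def matrix_vector_mult_scaleR real_sqrt_mult mult.assoc[symmetric])

lemma continuous_on_quad_norm: "continuous_on S (quad_norm P)"
  unfolding quad_norm_def[abs_def]
  by (intro continuous_intros linear_continuous_on) (simp add: linear_linear)

lemma kappa_nonneg:
  fixes P :: "real^'n^'n"
  assumes "transpose P = P" "\<And>x. x \<noteq> 0 \<Longrightarrow> 0 < x \<bullet> (P *v x)"
  shows "0 \<le> kappa P"
proof -
  obtain L :: "real^'n^'n" where "transpose L ** L = P"
    using positive_definite_factorization assms by blast
  then have "det P = det L * det L"
    by (metis det_mul det_transpose)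
  then have "0 \<le> det P"
    by simp
  moreover have "0 < lambda_min P"
    by (rule lambda_min_pos[OF assms])
  ultimately show ?thesis
    by (simp add: kappa_def)
qed

text \<open>
  If the gain of \<open>M\<close> exceeds \<open>G\<close> only on a set of directions of measure \<open>\<eta>\<close>, its overall
  gain cannot be much larger: a large gain in one direction \<open>v\<close> forces a large gain on a whole
  cap around \<open>v\<close>. The factor \<^term>\<open>kappa P\<close> accounts for the distortion of the uniform measure when
  the ellipsoid of \<open>P\<close> is transformed into a ball.
\<close>

lemma quad_norm_bound_from_bad_directions:
  fixes M P :: "real^'n^'n"
  assumes n: "CARD('n) \<ge> 2" and sym: "transpose P = P"
    and pos: "\<And>x. x \<noteq> 0 \<Longrightarrow> 0 < x \<bullet> (P *v x)" and G: "0 \<le> G"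
    and bad: "measure uniform_sphere {x \<in> sphere 0 1. G * quad_norm P x < quad_norm P (M *v x)} \<le> \<eta>"
    and small: "\<eta> * kappa P < 1"
  shows "quad_norm P (M *v x) \<le> G / zeta CARD('n) (\<eta> * kappa P / 2) * quad_norm P x"
proof -
  define k where "k = CARD('n) - 1"
  have k: "CARD('n) = Suc k" "k \<ge> 1" using n by (auto simp: k_def)
  define l where "l = lambda_min P"
  have l: "0 < l" "\<And>x. l * (x \<bullet> x) \<le> x \<bullet> (P *v x)"
    using lambda_min_pos[OF sym pos] lambda_min_le_quadratic_form[OF sym]
    by (auto simp: l_def)
  obtain L :: "real^'n^'n" where L: "transpose L ** L = P"
    using positive_definite_factorization[OF sym pos] by blast
  note qn = quad_norm_eq_norm[OF L]
  have detP: "det P = (det L)\<^sup>2"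
    by (simp add: L[symmetric] det_mul power2_eq_square)
  have "L *v x = 0 \<Longrightarrow> x = 0" for x
    using pos[of x] qn[of x] by (auto simp: quad_norm_def)
  then have detL: "det L \<noteq> 0"
    by (metis invertible_det_nz invertible_left_inverse matrix_left_invertible_ker)
  obtain L' where L': "L ** L' = mat 1" "L' ** L = mat 1" "det L' = 1 / det L"
    using inverse_matrix[OF detL] by metis
  have inv: "L *v (L' *v y) = y" "L' *v (L *v y) = y" for y
    by (simp_all add: matrix_vector_mul_assoc L')
  obtain v s where v: "norm v = 1" and s: "0 \<le> s"
    and upper: "\<And>y. norm ((L ** M ** L') *v y) \<le> s * norm y"
    and lower: "\<And>y. s * \<bar>v \<bullet> y\<bar> \<le> norm ((L ** M ** L') *v y)"
    using top_singular_vector[of "L ** M ** L'"] by metis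
  have conj: "quad_norm P (M *v (L' *v y)) = norm ((L ** M ** L') *v y)" for y
    by (simp add: qn matrix_vector_mul_assoc matrix_mul_assoc)
  define K where "K = {x. G * quad_norm P x < quad_norm P (M *v x)}"
  have K: "K \<in> sets borel"
    unfolding K_def
    by (intro borel_open open_Collect_less continuous_intros continuous_on_quad_norm
        continuous_on_compose2[OF continuous_on_quad_norm linear_continuous_on])
      (auto simp: linear_linear)
  have scaleK: "a *\<^sub>R x \<in> K \<longleftrightarrow> x \<in> K" if "a > 0" for a x
  proof -
    have "G * quad_norm P (a *\<^sub>R x) = a * (G * quad_norm P x)"
      "quad_norm P (M *v (a *\<^sub>R x)) = a * quad_norm P (M *v x)"
      using that by (simp_all add: quad_norm_scaleR matrix_vector_mult_scaleR)
    then have "a *\<^sub>R x \<in> K \<longleftrightarrow> a * (G * quad_norm P x) < a * quad_norm P (M *v x)"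
      unfolding K_def by (simp only: mem_Collect_eq)
    then show ?thesis using that by (simp add: K_def)
  qed
  have K0: "0 \<notin> K" by (simp add: K_def quad_norm_def)
  define \<theta> where "\<theta> = \<eta> * kappa P"
  have kap: "kappa P = \<bar>det L\<bar> / sqrt l ^ CARD('n)"
    by (simp only: kappa_def detP l_def real_sqrt_divide real_sqrt_abs real_sqrt_power[of "lambda_min P"])
  have kap0: "0 \<le> kappa P" using l(1) by (simp add: kap)
  have "0 \<le> \<eta>" using bad measure_nonneg order_trans by blast
  with kap0 have \<theta>: "0 \<le> \<theta>" "\<theta> < 1"
    using small by (auto simp: \<theta>_def)
  define z where "z = zeta CARD('n) (\<theta> / 2)"
  have z: "0 < z" "z \<le> 1" "cap_profile k (1 - z\<^sup>2) = \<theta> * cap_profile k 1"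
    using zeta_cap_profile[of "CARD('n)" "\<theta> / 2"] n \<theta> by (auto simp: z_def k_def)
  have "s \<le> G / z"
  proof (rule ccontr)
    assume "\<not> s \<le> G / z"
    then have sz: "G < s * z" using z by (simp add: field_simps)
    then have s0: "0 < s" using G z s by (metis mult_zero_left less_eq_real_def not_less)
    (* Choosing c strictly above G / s makes the closed cone condition below imply strict badness. *)
    with sz obtain c where c: "G / s < c" "c < z"
      using dense[of "G / s" z] by (auto simp: field_simps)
    have c01: "0 \<le> c" "c < 1"
      using c z G s0 by (auto intro: order_trans[OF divide_nonneg_pos[OF G s0]])
    define N where "N = matrix ((*\<^sub>R) (sqrt l)) ** L'"
    have N: "N *v y = sqrt l *\<^sub>R (L' *v y)" for y
      by (simp add: N_def matrix_vector_mul_assoc[symmetric] matrix_works linear_scale_self)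
    have detN: "\<bar>det N\<bar> = 1 / kappa P"
      using l(1) by (simp add: N_def det_mul L'(3) kap abs_mult power_abs)
    (* After the change of variables y = Lx the bad cone contains a double cone around v.
       The factor sqrt l makes the ball of radius 1 in the y variable land in the unit ball. *)
    have sub: "double_cone v c \<subseteq> (*v) N -` (K \<inter> ball 0 1)"
    proof
      fix y assume y: "y \<in> double_cone v c"
      define x where "x = L' *v y"
      have Lx: "L *v x = y" by (simp add: x_def inv)
      have y': "0 < norm y" "norm y < 1" "c * norm y \<le> \<bar>v \<bullet> y\<bar>"
        using y by (auto simp: double_cone_def)
      have "G * norm y < s * c * norm y"
        using c(1) s0 y'(1) by (simp add: field_simps)
      also have "\<dots> \<le> s * \<bar>v \<bullet> y\<bar>"
        using y'(3) s0 by (simp add: mult.assoc)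
      also have "\<dots> \<le> quad_norm P (M *v x)"
        using lower[of y] by (simp add: conj x_def)
      finally have "x \<in> K"
        by (simp add: K_def qn[of x] Lx)
      then have "sqrt l *\<^sub>R x \<in> K"
        using scaleK[of "sqrt l" x] l(1) by simp
      moreover have "norm (sqrt l *\<^sub>R x) \<le> norm y"
      proof -
        have "norm (sqrt l *\<^sub>R x) = sqrt (l * (x \<bullet> x))"
          using l(1) by (simp add: norm_eq_sqrt_inner[of x] real_sqrt_mult)
        also have "\<dots> \<le> quad_norm P x"
          using l(2) by (simp add: quad_norm_def)
        finally show ?thesis by (simp add: qn Lx)
      qed
      ultimately show "y \<in> (*v) N -` (K \<inter> ball 0 1)"
        using y'(2) by (simp add: N x_def)
    qed
    have KB: "K \<inter> ball 0 1 \<in> sets borel" "bounded (K \<inter> ball 0 1)"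
      using K by (auto intro: bounded_subset[OF bounded_ball[of 0 1]])
    have detN0: "det N \<noteq> 0"
      using detN detL kap l(1) by auto
    have V: "0 < unit_ball_vol k" by simp
    have "unit_ball_vol k * (2 * cap_profile k (1 - c\<^sup>2)) = measure lborel (double_cone v c)"
      by (rule measure_double_cone[OF v c01 k, symmetric])
    also have "\<dots> \<le> measure lborel ((*v) N -` (K \<inter> ball 0 1))"
      using sub borel_double_cone vimage_matrix_measure(1)[OF detN0 KB]
      by (intro measure_mono_fmeasurable) auto
    also have "\<dots> = measure lborel (K \<inter> ball 0 1) * kappa P"
      unfolding vimage_matrix_measure(2)[OF detN0 KB] detN by simp
    also have "\<dots> = measure uniform_sphere (K \<inter> sphere 0 1) * measure lborel (ball (0::real^'n) 1) * kappa P"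
      using measure_uniform_sphere_cone[OF K _ K0] scaleK
      by (simp add: sgn_div_norm)
    also have "\<dots> \<le> \<eta> * measure lborel (ball (0::real^'n) 1) * kappa P"
    proof -
      have "K \<inter> sphere 0 1 = {x \<in> sphere 0 1. G * quad_norm P x < quad_norm P (M *v x)}"
        by (auto simp: K_def)
      then show ?thesis
        using bad kap0 by (intro mult_right_mono) auto
    qed
    also have "\<dots> = unit_ball_vol k * (2 * cap_profile k (1 - z\<^sup>2))"
      by (simp add: measure_unit_ball[OF k] z(3) \<theta>_def)
    finally have "cap_profile k (1 - c\<^sup>2) \<le> cap_profile k (1 - z\<^sup>2)"
      using V by simp
    moreover have "1 - z\<^sup>2 < 1 - c\<^sup>2" "c\<^sup>2 \<le> 1" "z\<^sup>2 \<le> 1"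
      using c(2) c01 z by (auto simp: abs_square_le_1 power_strict_mono)
    ultimately show False
      using strict_mono_onD[OF strict_mono_on_cap_profile[OF k(2)], of "1 - z\<^sup>2" "1 - c\<^sup>2"] by simp
  qed
  moreover have "quad_norm P (M *v x) \<le> s * quad_norm P x"
    using upper[of "L *v x"] conj[of "L *v x"] by (simp add: inv qn[of x])
  moreover have "0 \<le> quad_norm P x" by (simp add: qn)
  ultimately show ?thesis
    unfolding z_def \<theta>_def by (meson mult_right_mono order_trans)
qed

section \<open>Quadratic norms and the joint spectral radius\<close>

lemma loewner_le_quadratic_form: "M \<preceq> N \<Longrightarrow> x \<bullet> (M *v x) \<le> x \<bullet> (N *v x)"
  by (auto simp: loewner_le_def pos_semidef_def matrix_vector_mult_diff_rdistrib inner_diff_right)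

lemma quad_feasible_bounds:
  assumes "quad_feasible \<delta> P"
  shows "transpose P = P" "norm x \<le> quad_norm P x" "quad_norm P x \<le> sqrt \<delta> * norm x"
    "x \<noteq> 0 \<Longrightarrow> 0 < x \<bullet> (P *v x)"
proof -
  have P: "transpose P = P" "mat 1 \<preceq> P" "P \<preceq> \<delta> *\<^sub>R mat 1"
    using assms by (auto simp: quad_feasible_def)
  have low: "x \<bullet> x \<le> x \<bullet> (P *v x)"
    using loewner_le_quadratic_form[OF P(2), of x] by simp
  have up: "x \<bullet> (P *v x) \<le> \<delta> * (x \<bullet> x)"
    using loewner_le_quadratic_form[OF P(3), of x] by (simp add: scaleR_matrix_vector_assoc[symmetric])
  show "transpose P = P" by (rule P)
  show "norm x \<le> quad_norm P x"
    using low by (simp add: quad_norm_def norm_eq_sqrt_inner)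
  show "quad_norm P x \<le> sqrt \<delta> * norm x"
    using up by (simp add: quad_norm_def norm_eq_sqrt_inner real_sqrt_mult[symmetric])
  show "x \<noteq> 0 \<Longrightarrow> 0 < x \<bullet> (P *v x)"
    using low inner_gt_zero_iff[of x] by linarith
qed

text \<open>
  Along a trajectory the norm of \<open>P\<close> contracts by \<open>r\<close> in each step; returning to the Euclidean
  norm costs the constant \<open>\<surd>\<delta>\<close> once.
\<close>

lemma joint_spectral_radius_le:
  assumes P: "quad_feasible \<delta> P" and \<delta>: "\<delta> \<ge> 1" and r: "0 \<le> r"
    and contr: "\<And>A x. A \<in> \<A> \<Longrightarrow> quad_norm P (A *v x) \<le> r * quad_norm P x"
  shows "joint_spectral_radius \<A> \<le> r"
proof -
  have "norm (\<xi> t) \<le> sqrt \<delta> * r ^ t * norm (\<xi> 0)" if "trajectory \<A> \<xi>" for \<xi> t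
  proof -
    have "quad_norm P (\<xi> t) \<le> r ^ t * quad_norm P (\<xi> 0)"
    proof (induction t)
      case (Suc t)
      have "\<xi> (Suc t) \<in> {A *v \<xi> t | A. A \<in> \<A>}"
        using that by (simp add: trajectory_def)
      then obtain A where "A \<in> \<A>" "\<xi> (Suc t) = A *v \<xi> t"
        by blast
      then have "quad_norm P (\<xi> (Suc t)) \<le> r * quad_norm P (\<xi> t)"
        using contr by simp
      also have "\<dots> \<le> r * (r ^ t * quad_norm P (\<xi> 0))"
        by (intro mult_left_mono Suc r)
      finally show ?case by (simp add: mult.assoc)
    qed simp
    also have "\<dots> \<le> r ^ t * (sqrt \<delta> * norm (\<xi> 0))"
      using r by (intro mult_left_mono quad_feasible_bounds[OF P]) simp
    finally show ?thesis
      using quad_feasible_bounds(2)[OF P, of "\<xi> t"] by (simp add: ac_simps)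
  qed
  then have "\<exists>C\<ge>1. \<forall>\<xi>. trajectory \<A> \<xi> \<longrightarrow> (\<forall>t. norm (\<xi> t) \<le> C * r ^ t * norm (\<xi> 0))"
    using \<delta> by (intro exI[of _ "sqrt \<delta>"]) simp
  then show ?thesis
    unfolding joint_spectral_radius_def using r
    by (intro cInf_lower) (auto intro!: bdd_belowI[of _ 0])
qed

text \<open>
  The supremum defining \<^const>\<open>quad_gain\<close> is over a bounded set because the norm of \<open>P\<close> and the
  Euclidean norm are equivalent; without boundedness it would carry no information.
\<close>

lemma quad_gain_bounds:
  fixes \<B> :: "(real^'n^'n) set"
  assumes P: "quad_feasible \<delta> P" and \<delta>: "\<delta> \<ge> 1" and \<B>: "finite \<B>" "\<B> \<noteq> {}"
  shows "B \<in> \<B> \<Longrightarrow> quad_norm P (B *v x) \<le> quad_gain P \<B> * quad_norm P x"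
    and "0 \<le> quad_gain P \<B>"
proof -
  have nn: "0 \<le> quad_norm P y" for y
    using quad_feasible_bounds(2)[OF P, of y] norm_ge_zero order_trans by blast
  have bdd1: "bdd_above ((\<lambda>x. quad_norm P (B *v x) / quad_norm P x) ` (UNIV - {0}))" for B
  proof (rule bdd_aboveI2)
    fix x :: "real^'n" assume "x \<in> UNIV - {0}"
    then have x: "0 < norm x" by simp
    have bl: "bounded_linear ((*v) B)" by (simp add: linear_linear)
    have "quad_norm P (B *v x) \<le> sqrt \<delta> * (onorm ((*v) B) * norm x)"
      by (rule order_trans[OF quad_feasible_bounds(3)[OF P] mult_left_mono[OF onorm[OF bl]]])
         (use \<delta> in simp)
    also have "\<dots> \<le> sqrt \<delta> * onorm ((*v) B) * quad_norm P x"
      using \<delta> onorm_pos_le[OF bl] quad_feasible_bounds(2)[OF P, of x]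
      by (simp add: mult.assoc mult_left_mono)
    finally show "quad_norm P (B *v x) / quad_norm P x \<le> sqrt \<delta> * onorm ((*v) B)"
      using less_le_trans[OF x quad_feasible_bounds(2)[OF P]] by (simp add: pos_divide_le_eq)
  qed
  let ?f = "\<lambda>(x, B). quad_norm P (B *v x) / quad_norm P x"
  have "?f ` ((UNIV - {0}) \<times> \<B>) = (\<Union>B\<in>\<B>. (\<lambda>x. quad_norm P (B *v x) / quad_norm P x) ` (UNIV - {0}))"
    by auto
  then have bdd: "bdd_above (?f ` ((UNIV - {0}) \<times> \<B>))"
    using \<B> bdd1 by (simp add: bdd_above_UN)
  have le: "quad_norm P (B *v x) / quad_norm P x \<le> quad_gain P \<B>" if "B \<in> \<B>" "x \<noteq> 0" for B x
    unfolding quad_gain_def using cSUP_upper[OF _ bdd, of "(x, B)"] that by simp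
  obtain x :: "real^'n" where x: "norm x = 1"
    using vector_choose_size[of 1, where 'a="real^'n"] by auto
  then have "x \<noteq> 0" by auto
  then show "0 \<le> quad_gain P \<B>"
    using le[of _ x] \<B>(2) nn by (meson all_not_in_conv divide_nonneg_nonneg order_trans)
  show "quad_norm P (B *v x) \<le> quad_gain P \<B> * quad_norm P x" if "B \<in> \<B>" for x
  proof (cases "x = 0")
    case False
    then have "0 < quad_norm P x"
      using quad_feasible_bounds(2)[OF P, of x] by (metis less_le_trans zero_less_norm_iff)
    then show ?thesis
      using le[OF that False] by (simp add: pos_divide_le_eq)
  qed (simp add: quad_norm_def)
qed

lemma quad_norm_triangle:
  fixes P :: "real^'n^'n"
  assumes "transpose P = P" "\<And>x. x \<noteq> 0 \<Longrightarrow> 0 < x \<bullet> (P *v x)"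
  shows "quad_norm P (x + y) \<le> quad_norm P x + quad_norm P y"
proof -
  obtain L :: "real^'n^'n" where "transpose L ** L = P"
    using positive_definite_factorization assms by blast
  then show ?thesis
    by (simp add: quad_norm_eq_norm matrix_vector_right_distrib norm_triangle_ineq)
qed

text \<open>
  Triangle inequality in the norm of \<open>P\<close>: an error of Euclidean norm \<open>r\<close> has norm at most
  \<open>r * \<surd>\<lambda>\<^sub>m\<^sub>a\<^sub>x\<close>, while the unit vector \<open>x\<close> has norm at least \<open>\<surd>\<lambda>\<^sub>m\<^sub>i\<^sub>n\<close>.
\<close>

lemma quad_norm_le_of_close:
  fixes P :: "real^'n^'n"
  assumes P: "quad_feasible \<delta> P" and x: "norm x = 1"
    and model: "quad_norm P y \<le> \<gamma> * quad_norm P x" and close: "norm (y - y') \<le> r"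
  shows "quad_norm P y' \<le> (\<gamma> + r * sqrt (kappa_bar P)) * quad_norm P x"
proof -
  note fb = quad_feasible_bounds[OF P]
  have lmin: "0 < lambda_min P"
    by (rule lambda_min_pos[OF fb(1,4)])
  have xx: "x \<bullet> x = 1" using x by (simp add: norm_eq_1)
  have lmax: "0 \<le> lambda_max P"
    using lmin lambda_min_le_lambda_max[OF fb(1)] by simp
  have "quad_norm P (y' - y) \<le> sqrt (lambda_max P * ((y' - y) \<bullet> (y' - y)))"
    unfolding quad_norm_def by (intro real_sqrt_le_mono quadratic_form_le_lambda_max fb)
  also have "\<dots> = sqrt (lambda_max P) * norm (y' - y)"
    by (simp add: real_sqrt_mult norm_eq_sqrt_inner)
  also have "\<dots> = sqrt (lambda_max P) * norm (y - y')"
    by (simp add: norm_minus_commute)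
  also have "\<dots> \<le> sqrt (lambda_max P) * r"
    using close lmax by (simp add: mult_left_mono)
  also have "\<dots> = r * sqrt (kappa_bar P) * sqrt (lambda_min P)"
    using lmin by (simp add: kappa_bar_def real_sqrt_divide)
  also have "\<dots> \<le> r * sqrt (kappa_bar P) * quad_norm P x"
  proof (rule mult_left_mono)
    show "sqrt (lambda_min P) \<le> quad_norm P x"
      using lambda_min_le_quadratic_form[OF fb(1), of x] xx by (simp add: quad_norm_def)
    have "0 \<le> r" using close norm_ge_zero order_trans by blast
    then show "0 \<le> r * sqrt (kappa_bar P)"
      using lmin lmax by (simp add: kappa_bar_def)
  qed
  finally have "quad_norm P (y' - y) \<le> r * sqrt (kappa_bar P) * quad_norm P x" .
  moreover have "quad_norm P (y + (y' - y)) \<le> quad_norm P y + quad_norm P (y' - y)"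
    by (rule quad_norm_triangle[OF fb(1,4)])
  ultimately show ?thesis
    using model by (simp add: distrib_right)
qed

section \<open>Prediction errors and bad directions\<close>
lemma prediction_error_greater_iff:
  assumes "m \<ge> 1"
  shows "prediction_error m A Ah (x, j, w) > r \<longleftrightarrow>
    (\<forall>k\<in>{1..m}. r < norm (Ah k *v x - A j *v x + w))"
  using assms by (simp add: prediction_error_def Min_gr_iff)

lemma prediction_error_event_measurable:
  fixes A Ah :: "nat \<Rightarrow> real^'n^'n"
  assumes m: "m \<ge> 1" and mode: "sets \<mu>_mode = sets (count_space {1..m})"
    and noise: "sets \<mu>_noise = sets (restrict_space borel \<W>)"
  defines "\<pi> \<equiv> uniform_sphere \<Otimes>\<^sub>M (\<mu>_mode \<Otimes>\<^sub>M \<mu>_noise)"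
  shows "{\<omega> \<in> space \<pi>. prediction_error m A Ah \<omega> > r} \<in> sets \<pi>"
proof -
  have "(\<lambda>x. x) \<in> measurable uniform_sphere (borel :: (real^'n) measure)"
    by (subst measurable_cong_sets[OF sets_uniform_sphere refl])
       (intro measurable_restrict_space1 measurable_ident_sets refl)
  then have x: "fst \<in> borel_measurable \<pi>"
    unfolding \<pi>_def by (rule measurable_compose[OF measurable_fst])
  have "(\<lambda>j. j) \<in> measurable \<mu>_mode (count_space UNIV)"
    by (subst measurable_cong_sets[OF mode refl]) simp
  then have j: "(\<lambda>\<omega>. fst (snd \<omega>)) \<in> measurable \<pi> (count_space UNIV)"
    unfolding \<pi>_def
    by (rule measurable_compose[OF measurable_compose[OF measurable_snd measurable_fst]])
  have "(\<lambda>w. w) \<in> measurable \<mu>_noise borel"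
    by (subst measurable_cong_sets[OF noise refl])
       (intro measurable_restrict_space1 measurable_ident_sets refl)
  then have w: "(\<lambda>\<omega>. snd (snd \<omega>)) \<in> borel_measurable \<pi>"
    unfolding \<pi>_def
    by (rule measurable_compose[OF measurable_compose[OF measurable_snd measurable_snd]])
  have mat: "(\<lambda>\<omega>. B *v fst \<omega>) \<in> borel_measurable \<pi>" for B :: "real^'n^'n"
    by (rule measurable_compose[OF x borel_measurable_linear]) simp
  have Aj: "(\<lambda>\<omega>. A (fst (snd \<omega>)) *v fst \<omega>) \<in> borel_measurable \<pi>"
    by (rule measurable_compose_countable[OF mat j])
  have "{\<omega> \<in> space \<pi>. \<forall>k\<in>{1..m}. r <
      norm (Ah k *v fst \<omega> - A (fst (snd \<omega>)) *v fst \<omega> + snd (snd \<omega>))} \<in> sets \<pi>"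
  proof (intro sets.sets_Collect_finite_All borel_measurable_less borel_measurable_const)
    show "(\<lambda>\<omega>. norm (Ah k *v fst \<omega> - A (fst (snd \<omega>)) *v fst \<omega> + snd (snd \<omega>))) \<in> borel_measurable \<pi>"
      for k
      by (rule measurable_compose[OF borel_measurable_add[OF borel_measurable_diff[OF mat Aj] w]
            borel_measurable_norm])
  qed simp
  moreover have "{\<omega> \<in> space \<pi>. prediction_error m A Ah \<omega> > r} = {\<omega> \<in> space \<pi>. \<forall>k\<in>{1..m}. r <
      norm (Ah k *v fst \<omega> - A (fst (snd \<omega>)) *v fst \<omega> + snd (snd \<omega>))}"
    by (intro Collect_cong conj_cong refl)
       (metis prediction_error_greater_iff[OF m] prod.collapse)
  ultimately show ?thesis by simp
qed

lemma mismatch_set_measurable: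
  fixes A Ah :: "nat \<Rightarrow> real^'n^'n"
  shows "{x \<in> sphere 0 1. \<forall>k\<in>{1..m}. r < norm (Ah k *v x - A j *v x)} \<in> sets uniform_sphere"
proof -
  have "open {x. r < norm (Ah k *v x - A j *v x)}" for k
    by (intro open_Collect_less continuous_intros linear_continuous_on) (auto simp: linear_linear)
  then have "(\<Inter>k\<in>{1..m}. {x. r < norm (Ah k *v x - A j *v x)}) \<in> sets borel"
    by (intro borel_open open_INT) auto
  moreover have "{x \<in> sphere 0 1. \<forall>k\<in>{1..m}. r < norm (Ah k *v x - A j *v x)} =
      sphere 0 1 \<inter> (\<Inter>k\<in>{1..m}. {x. r < norm (Ah k *v x - A j *v x)})"
    by auto
  ultimately show ?thesis
    by (auto simp: sets_uniform_sphere sets_restrict_space)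
qed

text \<open>
  The product of the mismatch set, the mode \<open>j\<close> and the noise values of norm at most \<open>W\<close> lies in
  the event of a large prediction error: such noise can reduce a mismatch above \<open>\<epsilon> + W\<close> by
  at most \<open>W\<close>.
\<close>

lemma mismatch_measure_le_Q_error:
  fixes A Ah :: "nat \<Rightarrow> real^'n^'n"
  assumes m: "m \<ge> 1"
    and prob: "prob_space \<mu>_mode" "prob_space \<mu>_noise"
    and sets: "sets \<mu>_mode = sets (count_space {1..m})" "sets \<mu>_noise = sets (restrict_space borel \<W>)"
    and j: "j \<in> {1..m}"
  shows "measure uniform_sphere {x \<in> sphere 0 1. \<forall>k\<in>{1..m}. \<epsilon> + W < norm (Ah k *v x - A j *v x)} *
      (measure \<mu>_mode {j} * (1 - measure \<mu>_noise {w \<in> \<W>. norm w > W}))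
    \<le> Q_error m A Ah \<mu>_mode \<mu>_noise \<epsilon>"
proof -
  interpret S: prob_space "uniform_sphere :: (real^'n) measure"
    by (rule prob_space_uniform_sphere)
  interpret M: prob_space \<mu>_mode by (rule prob)
  interpret N: prob_space \<mu>_noise by (rule prob)
  interpret MN: prob_space "\<mu>_mode \<Otimes>\<^sub>M \<mu>_noise" by (intro prob_space_pair prob)
  define \<pi> where "\<pi> = (uniform_sphere :: (real^'n) measure) \<Otimes>\<^sub>M (\<mu>_mode \<Otimes>\<^sub>M \<mu>_noise)"
  interpret \<pi>: prob_space \<pi>
    unfolding \<pi>_def by (intro prob_space_pair prob prob_space_uniform_sphere)
  define X where "X = {x \<in> sphere 0 1. \<forall>k\<in>{1..m}. \<epsilon> + W < norm (Ah k *v x - A j *v x)}"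
  define V where "V = {w \<in> \<W>. norm w \<le> W}"
  have X: "X \<in> sets uniform_sphere"
    unfolding X_def by (rule mismatch_set_measurable)
  have jm: "{j} \<in> sets \<mu>_mode" using j by (simp add: sets)
  have space: "space \<mu>_noise = \<W>" "space \<mu>_mode = {1..m}"
    using sets_eq_imp_space_eq[OF sets(2)] sets_eq_imp_space_eq[OF sets(1)]
    by (simp_all add: space_restrict_space)
  have cV: "{w \<in> \<W>. norm w > W} \<in> sets \<mu>_noise"
  proof -
    have "{w::real^'n. norm w > W} \<in> sets borel"
      by (intro borel_open open_Collect_less continuous_intros)
    moreover have "{w \<in> \<W>. norm w > W} = \<W> \<inter> {w. norm w > W}" by auto
    ultimately show ?thesis by (auto simp: sets sets_restrict_space)
  qed
  have V_eq: "V = space \<mu>_noise - {w \<in> \<W>. norm w > W}"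
    by (auto simp: V_def space)
  have V: "V \<in> sets \<mu>_noise" using cV by (simp add: V_eq)
  have "measure \<pi> (X \<times> ({j} \<times> V)) = measure uniform_sphere X * (measure \<mu>_mode {j} * measure \<mu>_noise V)"
    unfolding measure_def \<pi>_def using X jm V
    by (simp add: MN.emeasure_pair_measure_Times N.emeasure_pair_measure_Times enn2real_mult)
  moreover have "measure \<mu>_noise V = 1 - measure \<mu>_noise {w \<in> \<W>. norm w > W}"
    unfolding V_eq by (rule N.prob_compl[OF cV])
  moreover have "measure \<pi> (X \<times> ({j} \<times> V)) \<le> measure \<pi> {\<omega> \<in> space \<pi>. prediction_error m A Ah \<omega> > \<epsilon>}"
  proof (rule \<pi>.finite_measure_mono)
    show "{\<omega> \<in> space \<pi>. prediction_error m A Ah \<omega> > \<epsilon>} \<in> sets \<pi>"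
      unfolding \<pi>_def by (rule prediction_error_event_measurable[OF m sets])
    show "X \<times> ({j} \<times> V) \<subseteq> {\<omega> \<in> space \<pi>. prediction_error m A Ah \<omega> > \<epsilon>}"
    proof clarify
      fix x w assume x: "x \<in> X" and w: "w \<in> V"
      have "(x, j, w) \<in> space \<pi>"
        using x w j by (simp add: \<pi>_def space_pair_measure space space_uniform_sphere X_def V_def)
      moreover have "\<epsilon> < norm (Ah k *v x - A j *v x + w)" if "k \<in> {1..m}" for k
      proof -
        have "\<epsilon> + W < norm (Ah k *v x - A j *v x)" using x that by (simp add: X_def)
        moreover have "norm w \<le> W" using w by (simp add: V_def)
        ultimately show ?thesis
          using norm_diff_ineq[of "Ah k *v x - A j *v x" w] by linarith
      qed
      ultimately show "(x, j, w) \<in> space \<pi> \<and> prediction_error m A Ah (x, j, w) > \<epsilon>"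
        using prediction_error_greater_iff[OF m] by blast
    qed
  qed
  ultimately show ?thesis
    by (simp add: Q_error_def X_def \<pi>_def Let_def)
qed

theorem theorem12:
  fixes A Ah :: "nat \<Rightarrow> real^'n^'n"
    and P :: "real^'n^'n"
    and m :: nat
    and \<W> :: "(real^'n) set"
    and \<mu>_mode :: "nat measure"
    and \<mu>_noise :: "(real^'n) measure"
    and p :: "real \<Rightarrow> real"
    and \<delta> \<epsilon> W \<alpha> q :: real
  assumes "CARD('n) \<ge> 2"
    and "m \<ge> 1"
    and "prob_space \<mu>_mode"
    and "sets \<mu>_mode = sets (count_space {1..m})"
    and "prob_space \<mu>_noise"
    and "sets \<mu>_noise = sets (restrict_space borel \<W>)"
    and "\<And>s. s \<ge> 0 \<Longrightarrow> 0 \<le> p s \<and> p s \<le> 1"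
    and "\<delta> \<ge> 1"
    and "is_arg_min (\<lambda>P. quad_gain P (Ah ` {1..m})) (quad_feasible \<delta>) P"
    and "\<epsilon> > 0"
    and "W \<ge> 0"
    and "\<alpha> > 0"
    and "\<And>j. j \<in> {1..m} \<Longrightarrow> measure \<mu>_mode {j} \<ge> \<alpha>"
    and "\<And>s. s \<ge> 0 \<Longrightarrow> measure \<mu>_noise {w \<in> \<W>. norm w > s} \<le> p s"
    and "q \<ge> Q_error m A Ah \<mu>_mode \<mu>_noise \<epsilon>"
  shows "ereal (joint_spectral_radius (A ` {1..m})) \<le>
    (if p W = 1 \<or> q / (2 * (1 - p W) * \<alpha>) * kappa P \<ge> 1 / 2 then \<infinity>
     else ereal ((rho_quad (Ah ` {1..m}) \<delta> + (\<epsilon> + W) * sqrt (kappa_bar P)) /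
                 zeta CARD('n) (q / (2 * (1 - p W) * \<alpha>) * kappa P)))"
proof (cases "p W = 1 \<or> q / (2 * (1 - p W) * \<alpha>) * kappa P \<ge> 1 / 2")
  case False
  note m = assms(2)
  have pW: "p W < 1"
    using False assms(7)[OF assms(11)] by auto
  have P: "quad_feasible \<delta> P"
    using assms(9) by (simp add: is_arg_min_def)
  note fb = quad_feasible_bounds[OF P]
  define \<gamma> where "\<gamma> = quad_gain P (Ah ` {1..m})"
  have \<gamma>: "\<And>k x. k \<in> {1..m} \<Longrightarrow> quad_norm P (Ah k *v x) \<le> \<gamma> * quad_norm P x" "0 \<le> \<gamma>"
    using quad_gain_bounds[OF P assms(8), of "Ah ` {1..m}"] m by (auto simp: \<gamma>_def)
  have rho: "rho_quad (Ah ` {1..m}) \<delta> = \<gamma>"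
    unfolding rho_quad_def \<gamma>_def using assms(9)
    by (intro cInf_eq_minimum) (auto simp: is_arg_min_def not_less)
  define \<eta> where "\<eta> = q / ((1 - p W) * \<alpha>)"
  define G where "G = \<gamma> + (\<epsilon> + W) * sqrt (kappa_bar P)"
  have kbar: "0 \<le> kappa_bar P"
    using lambda_min_pos[OF fb(1,4)] lambda_min_le_lambda_max[OF fb(1)] by (simp add: kappa_bar_def)
  have G: "0 \<le> G"
    using \<gamma>(2) kbar assms(10,11) by (simp add: G_def)
  have arg: "q / (2 * (1 - p W) * \<alpha>) * kappa P = \<eta> * kappa P / 2"
    by (simp add: \<eta>_def)
  have small: "\<eta> * kappa P < 1"
    using False unfolding arg by simp
  have contr: "quad_norm P (A j *v x) \<le> G / zeta CARD('n) (\<eta> * kappa P / 2) * quad_norm P x"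
    if j: "j \<in> {1..m}" for j x
  proof (rule quad_norm_bound_from_bad_directions[OF assms(1) fb(1,4) G _ small])
    interpret S: prob_space "uniform_sphere :: (real^'n) measure"
      by (rule prob_space_uniform_sphere)
    let ?X = "{x \<in> sphere 0 1. \<forall>k\<in>{1..m}. \<epsilon> + W < norm (Ah k *v x - A j *v x)}"
    let ?t = "measure \<mu>_noise {w \<in> \<W>. norm w > W}"
    have "x \<in> ?X" if x: "norm x = 1" and bad: "G * quad_norm P x < quad_norm P (A j *v x)" for x
    proof -
      have "\<not> norm (Ah k *v x - A j *v x) \<le> \<epsilon> + W" if k: "k \<in> {1..m}" for k
        using quad_norm_le_of_close[OF P x \<gamma>(1)[OF k, of x], of "A j *v x" "\<epsilon> + W"] bad
        by (auto simp: G_def)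
      then show ?thesis using x by (simp add: not_le)
    qed
    then have "measure uniform_sphere {x \<in> sphere 0 1. G * quad_norm P x < quad_norm P (A j *v x)}
        \<le> measure uniform_sphere ?X"
      by (intro S.finite_measure_mono mismatch_set_measurable) auto
    also have "\<dots> \<le> \<eta>"
    proof -
      have "(1 - p W) * \<alpha> \<le> (1 - ?t) * measure \<mu>_mode {j}"
        using assms(13)[OF j] assms(14)[OF assms(11)] pW assms(12) by (intro mult_mono) auto
      then have "measure uniform_sphere ?X * ((1 - p W) * \<alpha>) \<le>
          measure uniform_sphere ?X * (measure \<mu>_mode {j} * (1 - ?t))"
        by (intro mult_left_mono) (simp_all add: mult.commute)
      also have "\<dots> \<le> q"
        using mismatch_measure_le_Q_error[OF m assms(3,5,4,6) j, of \<epsilon> W Ah A] assms(15)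
        by linarith
      finally show ?thesis
        using pW assms(12) by (simp add: \<eta>_def pos_le_divide_eq)
    qed
    finally show "measure uniform_sphere
        {x \<in> sphere 0 1. G * quad_norm P x < quad_norm P (A j *v x)} \<le> \<eta>" .
  qed
  have zeta0: "0 \<le> zeta CARD('n) (\<eta> * kappa P / 2)"
  proof -
    have "0 \<le> q"
      using assms(15) measure_nonneg order_trans unfolding Q_error_def Let_def by blast
    then have "0 \<le> \<eta> * kappa P / 2"
      using pW assms(12) kappa_nonneg[OF fb(1,4)] by (simp add: \<eta>_def)
    then show ?thesis
      using zeta_cap_profile(1)[OF assms(1)] small by (intro less_imp_le) auto
  qed
  have "joint_spectral_radius (A ` {1..m}) \<le> G / zeta CARD('n) (\<eta> * kappa P / 2)"
    using contr G zeta0 by (intro joint_spectral_radius_le[OF P assms(8)]) auto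
  then show ?thesis
    using False[unfolded arg] unfolding arg rho G_def[symmetric] by simp
qed simp

end
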